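(* Let $U\in\mathbb C^{n\times n}$ be a unitary matrix, $U_H=\frac{U+U^H}{2}$, $U_{AH}=\frac{U-U^H}{2}$, and let $\mathbf z\in\mathbb C^n$. Apply the algorithm Block_Lanczos to $U_H$ with the initial vectors $D_0=[\mathbf z\,|\,U\mathbf z]$. Assume that the set of vectors $U_H^{j-1}\mathbf z,\ U_H^{j-1}U\mathbf z$, $j\ge1$, yields a basis of the whole space $\mathbb C^n$ (i.e. these vectors span $\mathbb C^n$), or, equivalently, that the algorithm does not return an early termination warning. Then the unitary matrix $Q\in\mathbb C^{n\times n}$ produced by the algorithm reduces simultaneously $U_H$ and $U_{AH}$ into block tridiagonal form, that is, $$T_H:=Q^HU_HQ=\begin{bmatrix}A_1&B_1^H&&\\ B_1&A_2&\ddots&\\ &\ddots&\ddots&B_{p-1}^H\\ &&B_{p-1}&A_p\end{bmatrix}$$ and $$T_{AH}:=Q^HU_{AH}Q=\begin{bmatrix}A_1'&-B_1'^H&&\\ B_1'&A_2'&\ddots&\\ &\ddots&\ddots&-B_{p-1}'^H\\ &&B_{p-1}'&A_p'\end{bmatrix},$$ where $A_k,A_k'\in\mathbb C^{2\times2}$ and $B_k,B_k'\in\mathbb C^{2\times2}$ for all $k$, except that, when $n$ is odd, $A_p,A_p'\in\mathbb C^{1\times1}$ and $B_{p-1},B_{p-1}'\in\mathbb C^{1\times2}$.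
   Context: $M^H$ denotes the conjugate transpose of $M$. The algorithm Block_Lanczos (in exact arithmetic), with inputs the Hermitian matrix $U_H\in\mathbb C^{n\times n}$ and $D_0\in\mathbb C^{n\times 2}$, is the following. Compute a singular value decomposition $D_0=GRV^H$, set $i_1=\operatorname{rank}(D_0)$ and $Q_1=G(:,1:i_1)$ (an orthonormal basis of the column space of $D_0$). For $j=1,2,\dots$, as long as $i_1+\dots+i_j<n$: set $A_j=Q_j^HU_HQ_j$ and $$W_j=U_HQ_j-Q_jA_j-Q_{j-1}B_{j-1}^H$$ (the last term is omitted for $j=1$); compute a singular value decomposition $W_j=GRV^H$ and set $i_{j+1}=\operatorname{rank}(W_j)$; if $i_{j+1}=0$ the algorithm stops with an early (premature) termination warning; otherwise set $Q_{j+1}=G(:,1:i_{j+1})$ and $B_j=R(1:i_{j+1},1:i_{j+1})\,V(:,1:i_{j+1})^H\in\mathbb C^{i_{j+1}\times i_j}$, so that $W_j=Q_{j+1}B_j$. When $i_1+\dots+i_p=n$ for some $p$ the algorithm sets $A_p=Q_p^HU_HQ_p$ and terminates without early termination, returning the unitary matrix $Q=[Q_1\,|\,\cdots\,|\,Q_p]\in\mathbb C^{n\times n}$. *)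

theory Defs
  imports
    "Jordan_Normal_Form.DL_Rank"
    "Jordan_Normal_Form.Schur_Decomposition"
begin

definition unitary_mat :: "nat \<Rightarrow> complex mat \<Rightarrow> bool" where
  "unitary_mat n U \<longleftrightarrow>
     U \<in> carrier_mat n n \<and> mat_adjoint U * U = 1\<^sub>m n \<and> U * mat_adjoint U = 1\<^sub>m n"

definition herm_part :: "complex mat \<Rightarrow> complex mat" where
  "herm_part U = (1/2) \<cdot>\<^sub>m (U + mat_adjoint U)"

definition antiherm_part :: "complex mat \<Rightarrow> complex mat" where
  "antiherm_part U = (1/2) \<cdot>\<^sub>m (U - mat_adjoint U)"

text \<open>\<open>M = G R V\<^sup>H\<close> with square unitary factors and a rectangular diagonal \<open>R\<close> whose entries are
  nonnegative and nonincreasing. As only leading columns of the factors are used below, economy-size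
  decompositions would lead to the same runs of the algorithm.\<close>

definition is_svd :: "complex mat \<Rightarrow> complex mat \<Rightarrow> complex mat \<Rightarrow> complex mat \<Rightarrow> bool" where
  "is_svd M G R V \<longleftrightarrow>
     unitary_mat (dim_row M) G \<and> unitary_mat (dim_col M) V \<and>
     (\<exists>\<sigma> :: nat \<Rightarrow> real.
        (\<forall>i < min (dim_row M) (dim_col M). 0 \<le> \<sigma> i) \<and>
        (\<forall>i j. i \<le> j \<and> j < min (dim_row M) (dim_col M) \<longrightarrow> \<sigma> j \<le> \<sigma> i) \<and>
        R = mat (dim_row M) (dim_col M) (\<lambda>(i, j). if i = j then complex_of_real (\<sigma> i) else 0)) \<and>
     M = G * R * mat_adjoint V"

definition leading_block :: "complex mat \<Rightarrow> nat \<Rightarrow> nat \<Rightarrow> complex mat" where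
  "leading_block M r c = mat r c (\<lambda>(i, j). M $$ (i, j))"

definition mat_rank :: "complex mat \<Rightarrow> nat" where
  "mat_rank M = vec_space.rank (dim_row M) M"

text \<open>The matrix \<open>W\<^sub>j\<close>, given \<open>[Q\<^sub>1, \<dots>, Q\<^sub>j]\<close> and \<open>[B\<^sub>1, \<dots>, B\<^bsub>j-1\<^esub>]\<close>.\<close>

definition lanczos_residual ::
  "complex mat \<Rightarrow> complex mat list \<Rightarrow> complex mat list \<Rightarrow> complex mat" where
  "lanczos_residual H Qs Bs =
     (let Q = last Qs;
          A = mat_adjoint Q * H * Q;
          W = H * Q - Q * A
      in if Bs = [] then W else W - last (butlast Qs) * mat_adjoint (last Bs))"

text \<open>The states \<open>[Q\<^sub>1, \<dots>, Q\<^sub>j]\<close>, \<open>[A\<^sub>1, \<dots>, A\<^bsub>j-1\<^esub>]\<close>, \<open>[B\<^sub>1, \<dots>, B\<^bsub>j-1\<^esub>]\<close> that the algorithm can reach.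
  Singular value decompositions are not unique, so this is a relation: every choice is allowed.\<close>

inductive lanczos_state ::
  "nat \<Rightarrow> complex mat \<Rightarrow> complex mat \<Rightarrow>
   complex mat list \<Rightarrow> complex mat list \<Rightarrow> complex mat list \<Rightarrow> bool"
  for n :: nat and H D0 :: "complex mat" where
  init: "is_svd D0 G R V \<Longrightarrow> lanczos_state n H D0 [leading_block G n (mat_rank D0)] [] []"
| step: "lanczos_state n H D0 Qs As Bs \<Longrightarrow>
     sum_list (map dim_col Qs) < n \<Longrightarrow>
     is_svd (lanczos_residual H Qs Bs) G R V \<Longrightarrow>
     r = mat_rank (lanczos_residual H Qs Bs) \<Longrightarrow>
     r \<noteq> 0 \<Longrightarrow>
     lanczos_state n H D0
       (Qs @ [leading_block G n r])
       (As @ [mat_adjoint (last Qs) * H * last Qs])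
       (Bs @ [leading_block R r r * mat_adjoint (leading_block V (dim_row V) r)])"

text \<open>\<open>Completed Q As Bs\<close> also records the computed blocks \<open>As = [A\<^sub>1, \<dots>, A\<^sub>p]\<close> and
  \<open>Bs = [B\<^sub>1, \<dots>, B\<^bsub>p-1\<^esub>]\<close>.\<close>

datatype lanczos_outcome =
    Early_Termination
  | Completed "complex mat" "complex mat list" "complex mat list"

inductive block_lanczos :: "nat \<Rightarrow> complex mat \<Rightarrow> complex mat \<Rightarrow> lanczos_outcome \<Rightarrow> bool"
  for n :: nat and H D0 :: "complex mat" where
  early: "lanczos_state n H D0 Qs As Bs \<Longrightarrow>
     sum_list (map dim_col Qs) < n \<Longrightarrow>
     mat_rank (lanczos_residual H Qs Bs) = 0 \<Longrightarrow>
     block_lanczos n H D0 Early_Termination"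
| completed: "lanczos_state n H D0 Qs As Bs \<Longrightarrow>
     sum_list (map dim_col Qs) = n \<Longrightarrow>
     block_lanczos n H D0
       (Completed (mat_of_cols n (concat (map cols Qs)))
          (As @ [mat_adjoint (last Qs) * H * last Qs]) Bs)"

definition krylov_vectors :: "complex mat \<Rightarrow> complex vec \<Rightarrow> complex vec set" where
  "krylov_vectors U z =
     {(herm_part U ^\<^sub>m (j - 1)) *\<^sub>v z | j. j \<ge> 1} \<union>
     {(herm_part U ^\<^sub>m (j - 1)) *\<^sub>v (U *\<^sub>v z) | j. j \<ge> 1}"

definition spans_space :: "nat \<Rightarrow> complex vec set \<Rightarrow> bool" where
  "spans_space n S \<longleftrightarrow>
     LinearCombinations.module.span class_ring (module_vec TYPE(complex) n) S = carrier_vec n"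

definition zero_pad :: "nat \<Rightarrow> nat \<Rightarrow> complex mat \<Rightarrow> complex mat" where
  "zero_pad r c M =
     mat r c (\<lambda>(i, j). if i < dim_row M \<and> j < dim_col M then M $$ (i, j) else 0)"

text \<open>Block tridiagonal matrix with the given diagonal, subdiagonal and superdiagonal blocks; the
  last equation is a dummy for lists of incompatible lengths.\<close>

fun block_tridiag ::
  "complex mat list \<Rightarrow> complex mat list \<Rightarrow> complex mat list \<Rightarrow> complex mat" where
  "block_tridiag [A] [] [] = A"
| "block_tridiag (A # As) (B # Bs) (C # Cs) =
     (let T = block_tridiag As Bs Cs
      in four_block_mat
           A (zero_pad (dim_row A) (dim_col T) C)
           (zero_pad (dim_row T) (dim_col A) B) T)"
| "block_tridiag _ _ _ = 0\<^sub>m 0 0"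

text \<open>Size of the block with 0-based index \<open>k\<close> among \<open>p\<close> diagonal blocks.\<close>

definition block_size :: "nat \<Rightarrow> nat \<Rightarrow> nat \<Rightarrow> nat" where
  "block_size n p k = (if odd n \<and> Suc k = p then 1 else 2)"

definition blocks_of_size :: "nat \<Rightarrow> nat \<Rightarrow> complex mat list \<Rightarrow> complex mat list \<Rightarrow> bool" where
  "blocks_of_size n p As Bs \<longleftrightarrow>
     length As = p \<and> Suc (length Bs) = p \<and>
     (\<forall>k < p. As ! k \<in> carrier_mat (block_size n p k) (block_size n p k)) \<and>
     (\<forall>k. Suc k < p \<longrightarrow> Bs ! k \<in> carrier_mat (block_size n p (Suc k)) (block_size n p k))"

end

theory Submission
  imports Defs
begin

text \<open>Write \<open>H\<close> and \<open>K\<close> for the Hermitian and the skew-Hermitian part of \<open>U\<close>, and \<open>u\<^sub>k = U\<^sup>k z\<close> for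
every integer \<open>k\<close>. As the adjoint of \<open>U\<close> is its inverse,
\<open>H u\<^sub>k = (u\<^bsub>k+1\<^esub> + u\<^bsub>k-1\<^esub>) / 2\<close> and \<open>K u\<^sub>k = (u\<^bsub>k+1\<^esub> - u\<^bsub>k-1\<^esub>) / 2\<close>.
So both parts widen a window \<open>W\<^sub>j = span {u\<^bsub>-j\<^esub>, \<dots>, u\<^bsub>j+1\<^esub>}\<close> by at most one step at each end, and
each \<open>W\<^sub>j\<close> is the space that at most \<open>j\<close> applications of \<open>H\<close> generate from \<open>W\<^sub>0 = span {z, U z}\<close>.

Counting blocks from \<open>0\<close>, the invariant of the algorithm is that \<open>Q\<^sub>0, \<dots>, Q\<^sub>j\<close> are orthonormal and
that their columns together span \<open>W\<^sub>j\<close> (\<open>next_block\<close>, \<open>lanczos_state_blocks\<close>). The three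
claims follow from it.

\<^item> Block tridiagonal form. For \<open>X \<in> {H, K}\<close> the columns of \<open>X Q\<^sub>i\<close> lie in \<open>W\<^bsub>i+1\<^esub>\<close>, so they are
  orthogonal to \<open>Q\<^sub>k\<close> for \<open>k > i + 1\<close>. As \<open>X\<close> equals its adjoint up to sign, the blocks far above the
  diagonal vanish too, and the superdiagonal blocks are the adjoints of the subdiagonal ones with the
  same sign (\<open>far_blocks_zero\<close>, \<open>congruence_tridiagonal\<close>).

\<^item> Block sizes. No block has more than two columns. If one of \<open>Q\<^sub>0, \<dots>, Q\<^sub>j\<close> had fewer than two, then
  the \<open>2j + 2\<close> vectors spanning \<open>W\<^sub>j\<close> would be linearly dependent. A linear relation among
  consecutive powers can be shifted along the orbit, so \<open>W\<^sub>j\<close> would contain \<open>u\<^bsub>j+2\<^esub>\<close> and \<open>u\<^bsub>-j-1\<^esub>\<close>,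
  whence \<open>W\<^bsub>j+1\<^esub> = W\<^sub>j\<close> and there would be no room for another block
  (\<open>small_window_extends\<close>, \<open>nonlast_width\<close>). So only the last block can have a single column, and the
  parity of \<open>n\<close> decides whether it does.

\<^item> Early termination. A zero residual makes \<open>W\<^sub>j\<close> invariant under \<open>H\<close>, so it contains all Krylov
  vectors; being spanned by fewer than \<open>n\<close> columns, it is not the whole space. Conversely \<open>n\<close>
  orthonormal columns span the whole space, and every \<open>u\<^sub>k\<close> is a combination of Krylov vectors
  (\<open>early_imp_not_spanning\<close>, \<open>completed_imp_spanning\<close>).\<close>

section \<open>Adjoints of complex matrices\<close>

lemma index_mult_mat_sum:
  assumes "A \<in> carrier_mat r m" "B \<in> carrier_mat m c" "i < r" "j < c"
  shows "(A * B) $$ (i, j) = (\<Sum>k<m. A $$ (i, k) * B $$ (k, j))"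
  using assms by (auto simp: scalar_prod_def atLeast0LessThan)

lemma minus_zero_mat: "(M :: 'a :: group_add mat) \<in> carrier_mat r c \<Longrightarrow> M - 0\<^sub>m r c = M"
  by (intro eq_matI) auto

lemma col_minus_minus:
  fixes X Y Z :: "'a :: ab_group_add mat"
  assumes "X \<in> carrier_mat r c" "Y \<in> carrier_mat r c" "Z \<in> carrier_mat r c" "k < c"
  shows "col (X - Y - Z) k = col X k - col Y k - col Z k"
  using assms by (intro eq_vecI) auto

lemma col_minus_minus_add_back:
  fixes X Y Z :: "'a :: ab_group_add mat"
  assumes "X \<in> carrier_mat r c" "Y \<in> carrier_mat r c" "Z \<in> carrier_mat r c" "k < c"
  shows "col X k = col (X - Y - Z) k + col Y k + col Z k"
  using assms by (intro eq_vecI) auto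

lemma mat_adjoint_dim [simp]:
  "dim_row (mat_adjoint A) = dim_col A" "dim_col (mat_adjoint A) = dim_row A"
  by (simp_all only: mat_adjoint_def mat_of_rows_carrier length_map cols_length)

lemma mat_adjoint_carrier [simp]: "mat_adjoint A \<in> carrier_mat c r \<longleftrightarrow> A \<in> carrier_mat r c"
  by (metis carrier_matD carrier_matI mat_adjoint_dim)

lemma mat_adjoint_index [simp]:
  "i < dim_col A \<Longrightarrow> j < dim_row A \<Longrightarrow> mat_adjoint A $$ (i, j) = conjugate (A $$ (j, i))"
  by (simp add: mat_adjoint_def mat_of_rows_index)

lemma mat_adjoint_adjoint [simp]: "mat_adjoint (mat_adjoint A) = A"
  by (rule eq_matI) auto

lemma mat_adjoint_mult:
  fixes A B :: "complex mat"
  assumes "A \<in> carrier_mat r m" "B \<in> carrier_mat m c"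
  shows "mat_adjoint (A * B) = mat_adjoint B * mat_adjoint A"
  using assms by (intro eq_matI) (auto simp: scalar_prod_def mult.commute)

lemma mat_adjoint_zero [simp]: "mat_adjoint (0\<^sub>m r c :: complex mat) = 0\<^sub>m c r"
  by (intro eq_matI) auto

lemma mat_adjoint_sandwich:
  fixes P Q X :: "complex mat"
  assumes "P \<in> carrier_mat n r" "Q \<in> carrier_mat n c" "X \<in> carrier_mat n n"
  shows "mat_adjoint (mat_adjoint P * X * Q) = mat_adjoint Q * mat_adjoint X * P"
proof -
  have "mat_adjoint (mat_adjoint P * X * Q) = mat_adjoint Q * (mat_adjoint X * P)"
    using assms by (simp add: mat_adjoint_mult[of _ r n _ c] mat_adjoint_mult[of _ n n _ c])
  then show ?thesis using assms by (simp add: assoc_mult_mat[of _ c n _ n _ r])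
qed

section \<open>Spans, ranks and dependent families\<close>

context vec_space
begin

lemma span_subset_closed_set:
  assumes "S \<subseteq> N" "N \<subseteq> carrier_vec n" "0\<^sub>v n \<in> N"
    and "\<And>v w. v \<in> N \<Longrightarrow> w \<in> N \<Longrightarrow> v + w \<in> N"
    and "\<And>a v. v \<in> N \<Longrightarrow> a \<cdot>\<^sub>v v \<in> N"
  shows "span S \<subseteq> N"
proof (rule span_is_subset[OF assms(1)])
  show "submodule class_ring N V"
    unfolding submodule_def using assms(2-) module_axioms by auto
qed

lemma span_closed_carrier: "S \<subseteq> carrier_vec n \<Longrightarrow> v \<in> span S \<Longrightarrow> v \<in> carrier_vec n"
  using span_is_subset2[of S] by auto

lemma span_zero_mem: "S \<subseteq> carrier_vec n \<Longrightarrow> 0\<^sub>v n \<in> span S"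
  using submodule.zero_closed[OF span_is_submodule[of S]] by simp

lemma span_add_mem: "S \<subseteq> carrier_vec n \<Longrightarrow> v \<in> span S \<Longrightarrow> w \<in> span S \<Longrightarrow> v + w \<in> span S"
  using submodule.m_closed[OF span_is_submodule[of S]] by simp

lemma span_minus_mem:
  assumes "S \<subseteq> carrier_vec n" "v \<in> span S" "w \<in> span S"
  shows "v - w \<in> span S"
proof -
  have "v - w = v + (- 1) \<cdot>\<^sub>v w"
    using assms span_closed_carrier[OF assms(1)] by (intro eq_vecI) auto
  then show ?thesis using assms by (simp add: span_add_mem smult_in_span)
qed

lemma mult_mat_vec_mem_span:
  assumes A: "A \<in> carrier_mat n n" and S: "S \<subseteq> carrier_vec n" and T: "T \<subseteq> carrier_vec n"
    and gen: "\<And>s. s \<in> S \<Longrightarrow> A *\<^sub>v s \<in> span T" and v: "v \<in> span S"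
  shows "A *\<^sub>v v \<in> span T"
proof -
  have "A *\<^sub>v 0\<^sub>v n = 0\<^sub>v n" using A by auto
  then have "span S \<subseteq> {v \<in> carrier_vec n. A *\<^sub>v v \<in> span T}"
    using A S gen span_zero_mem[OF T] span_add_mem[OF T] smult_in_span[OF T]
    by (intro span_subset_closed_set)
      (auto simp: mult_add_distrib_mat_vec[OF A] mult_mat_vec[OF A])
  then show ?thesis using v by auto
qed

lemma mult_mat_vec_span_eq_zero:
  assumes A: "A \<in> carrier_mat k n" and S: "S \<subseteq> carrier_vec n"
    and gen: "\<And>s. s \<in> S \<Longrightarrow> A *\<^sub>v s = 0\<^sub>v k" and v: "v \<in> span S"
  shows "A *\<^sub>v v = 0\<^sub>v k"
proof -
  have "span S \<subseteq> {v \<in> carrier_vec n. A *\<^sub>v v = 0\<^sub>v k}"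
    using A S gen
    by (intro span_subset_closed_set)
      (auto simp: mult_add_distrib_mat_vec[OF A] mult_mat_vec[OF A])
  then show ?thesis using v by auto
qed

lemma span_cols_mult_subset:
  assumes "A \<in> carrier_mat n m" "B \<in> carrier_mat m c"
  shows "span (set (cols (A * B))) \<subseteq> span (set (cols A))"
proof -
  have "\<exists>x\<in>carrier_vec m. A *\<^sub>v x = A * B *\<^sub>v y" if "y \<in> carrier_vec c" for y
    using assms that by (intro bexI[of _ "B *\<^sub>v y"]) auto
  then show ?thesis
    using assms col_space_eq[of A m] col_space_eq[of "A * B" c] unfolding col_space_def by auto
qed

lemma set_cols_carrier: "A \<in> carrier_mat n m \<Longrightarrow> set (cols A) \<subseteq> carrier_vec n"
  using cols_dim[of A] by auto

lemma mult_mat_vec_mem_span_cols: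
  assumes "A \<in> carrier_mat n m" "x \<in> carrier_vec m"
  shows "A *\<^sub>v x \<in> span (set (cols A))"
  using assms col_space_eq[of A m] unfolding col_space_def by auto

text \<open>Left invertibility rules out repeated columns as well as linear relations, so the column set has full size.\<close>

lemma rank_left_invertible:
  assumes A: "A \<in> carrier_mat n k" and L: "L \<in> carrier_mat k n" and inv: "L * A = 1\<^sub>m k"
  shows "rank A = k"
proof (rule lin_indpt_full_rank[OF A])
  show dist: "distinct (cols A)"
  proof (unfold distinct_conv_nth, intro allI impI)
    fix i j assume ij: "i < length (cols A)" "j < length (cols A)" "i \<noteq> j"
    have "col (L * A) i \<noteq> col (L * A) j"
    proof
      assume "col (L * A) i = col (L * A) j"
      then have "col (1\<^sub>m k) i $ i = col (1\<^sub>m k :: 'a mat) j $ i" by (simp add: inv)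
      then show False using ij A by auto
    qed
    then show "cols A ! i \<noteq> cols A ! j" using ij A L by auto
  qed
  show "lin_indpt (set (cols A))"
  proof
    assume "lin_dep (set (cols A))"
    then obtain v where v: "v \<in> carrier_vec k" "v \<noteq> 0\<^sub>v k" "A *\<^sub>v v = 0\<^sub>v n"
      using lin_depE[OF A _ dist] by blast
    have "v = (L * A) *\<^sub>v v" using v inv by simp
    also have "\<dots> = L *\<^sub>v (A *\<^sub>v v)" using A L v by auto
    also have "\<dots> = 0\<^sub>v k" using v L by auto
    finally show False using v by simp
  qed
qed

lemma rank_zero_imp_zero:
  assumes A: "A \<in> carrier_mat n c" and "rank A = 0"
  shows "A = 0\<^sub>m n c"
proof (rule ccontr)
  assume "A \<noteq> 0\<^sub>m n c"
  then obtain i j where ij: "i < n" "j < c" "A $$ (i, j) \<noteq> 0"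
    using A by (metis carrier_matD eq_matI index_zero_mat)
  have "lin_indpt {col A j}"
  proof
    assume "lin_dep {col A j}"
    then obtain a where "lincomb a {col A j} = 0\<^sub>v n" "a (col A j) \<noteq> 0"
      using finite_lin_dep[of "{col A j}"] A ij by auto
    then have "a (col A j) \<cdot>\<^sub>v col A j = 0\<^sub>v n" using A ij by (simp add: lincomb_def)
    then have "(a (col A j) \<cdot>\<^sub>v col A j) $ i = 0" using ij by simp
    then show False using \<open>a (col A j) \<noteq> 0\<close> ij A by simp
  qed
  then have "card {col A j} \<le> rank A"
    using A ij by (intro rank_ge_card_indpt) (auto simp: cols_def)
  then show False using assms by simp
qed

text \<open>Taking the dependent vector in the span of its predecessors gives the relation a leading term. Read from
either end of a segment of an orbit, such a relation can be shifted along the orbit.\<close>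

lemma more_vectors_than_generators:
  assumes S: "finite S" "S \<subseteq> carrier_vec n" and ws: "set ws \<subseteq> span S" and len: "card S < length ws"
  shows "\<exists>h < length ws. ws ! h \<in> span (set (take h ws))"
proof (rule ccontr)
  assume no: "\<not> ?thesis"
  have vsc: "set ws \<subseteq> carrier_vec n" using ws span_closed_carrier[OF S(2)] by auto
  have "lin_indpt (set (take h ws)) \<and> distinct (take h ws)" if "h \<le> length ws" for h
    using that
  proof (induction h)
    case 0
    show ?case by (simp add: lin_dep_def)
  next
    case (Suc h)
    let ?T = "set (take h ws)"
    have T: "?T \<subseteq> carrier_vec n" using vsc set_take_subset[of h ws] by blast
    have out: "ws ! h \<notin> span ?T" using no Suc by auto
    have nin: "ws ! h \<notin> ?T" using out in_own_span[of ?T] T by auto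
    have whc: "ws ! h \<in> carrier_vec n" using vsc Suc.prems nth_mem[of h ws] by (meson Suc_le_lessD subsetD)
    have "lin_indpt (?T \<union> {ws ! h})"
      using lin_dep_iff_in_span[of ?T "ws ! h"] out T whc Suc nin by auto
    then show ?case using Suc nin by (simp add: take_Suc_conv_app_nth)
  qed
  from this[of "length ws"] have li: "lin_indpt (set ws)" "distinct ws" by auto
  have "card (set ws) \<le> card S"
    using replacement[of "set ws" S] S ws li by auto
  then show False using len distinct_card[OF li(2)] by simp
qed

end

section \<open>Rank factorization from a singular value decomposition\<close>

lemma leading_block_carrier [simp]: "leading_block M r c \<in> carrier_mat r c"
  by (simp add: leading_block_def)

lemma leading_columns_orthonormal:
  assumes "unitary_mat d G" "k \<le> d"
  shows "mat_adjoint (leading_block G d k) * leading_block G d k = 1\<^sub>m k"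
proof (rule eq_matI)
  fix i j assume ij: "i < dim_row (1\<^sub>m k :: complex mat)" "j < dim_col (1\<^sub>m k :: complex mat)"
  have "G \<in> carrier_mat d d" using assms by (simp add: unitary_mat_def)
  then have "(mat_adjoint (leading_block G d k) * leading_block G d k) $$ (i, j) = (mat_adjoint G * G) $$ (i, j)"
    using assms(2) ij by (simp add: leading_block_def scalar_prod_def)
  then show "(mat_adjoint (leading_block G d k) * leading_block G d k) $$ (i, j) = 1\<^sub>m k $$ (i, j)"
    using assms ij by (simp add: unitary_mat_def)
qed (simp_all add: leading_block_def)

text \<open>Because the singular values decrease, the nonzero ones are exactly the first \<open>r\<close>, so cutting the three
factors to size \<open>r\<close> loses nothing. The right inverse of \<open>B\<close> says that \<open>Q\<close> and \<open>M\<close> have the same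
column space.\<close>

lemma svd_factorization:
  assumes M: "M \<in> carrier_mat n c" and svd: "is_svd M G R V" and r: "r = mat_rank M"
  defines "Q \<equiv> leading_block G n r"
    and "B \<equiv> leading_block R r r * mat_adjoint (leading_block V (dim_row V) r)"
  shows "r \<le> n" "r \<le> c" "Q \<in> carrier_mat n r" "B \<in> carrier_mat r c" "M = Q * B"
    "mat_adjoint Q * Q = 1\<^sub>m r" "\<exists>C \<in> carrier_mat c r. B * C = 1\<^sub>m r"
proof -
  obtain \<sigma> :: "nat \<Rightarrow> real" where G: "unitary_mat n G" and V: "unitary_mat c V"
    and pos: "\<And>i. i < min n c \<Longrightarrow> 0 \<le> \<sigma> i"
    and decr: "\<And>i j. i \<le> j \<Longrightarrow> j < min n c \<Longrightarrow> \<sigma> j \<le> \<sigma> i"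
    and R: "R = mat n c (\<lambda>(i, j). if i = j then complex_of_real (\<sigma> i) else 0)"
    and MG: "M = G * R * mat_adjoint V"
    using svd M unfolding is_svd_def by auto
  have Gc: "G \<in> carrier_mat n n" and Vc: "V \<in> carrier_mat c c" and Rc: "R \<in> carrier_mat n c"
    using G V R by (auto simp: unitary_mat_def)
  \<comment> \<open>\<open>k\<close> counts the nonzero singular values; that it equals the rank is the last thing proved.\<close>
  define k where "k = (LEAST i. i \<ge> min n c \<or> \<sigma> i = 0)"
  have k: "k \<ge> min n c \<or> \<sigma> k = 0" unfolding k_def by (rule LeastI[of _ "min n c"]) simp
  have small: "i < min n c \<and> \<sigma> i \<noteq> 0" if "i < k" for i
    using not_less_Least[of i "\<lambda>i. i \<ge> min n c \<or> \<sigma> i = 0"] that unfolding k_def by auto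
  have kle: "k \<le> min n c" unfolding k_def by (rule Least_le) simp
  have large: "\<sigma> i = 0" if "k \<le> i" "i < min n c" for i
  proof -
    have "\<sigma> k = 0" using k that by auto
    then show ?thesis using decr[of k i] pos[of i] that by auto
  qed
  define Q' where "Q' = leading_block G n k"
  define V' where "V' = leading_block V c k"
  define R' where "R' = leading_block R k k"
  define B' where "B' = R' * mat_adjoint V'"
  define D where "D = mat k k (\<lambda>(i, j). if i = j then complex_of_real (1 / \<sigma> i) else 0)"
  have c': "Q' \<in> carrier_mat n k" "V' \<in> carrier_mat c k" "R' \<in> carrier_mat k k"
      "D \<in> carrier_mat k k"
    by (auto simp: Q'_def V'_def R'_def D_def)
  then have Bc: "B' \<in> carrier_mat k c" by (simp add: B'_def)
  have Q1: "mat_adjoint Q' * Q' = 1\<^sub>m k" and V1: "mat_adjoint V' * V' = 1\<^sub>m k"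
    unfolding Q'_def V'_def using leading_columns_orthonormal[OF G] leading_columns_orthonormal[OF V] kle by auto
  have GR: "(G * R) $$ (a, j) = (if j < k then G $$ (a, j) * \<sigma> j else 0)" if "a < n" "j < c" for a j
  proof -
    have "(G * R) $$ (a, j) = (\<Sum>i<n. G $$ (a, i) * (if i = j then complex_of_real (\<sigma> i) else 0))"
      using Gc that R by (auto simp: scalar_prod_def atLeast0LessThan)
    also have "\<dots> = (\<Sum>i<n. if i = j then G $$ (a, i) * \<sigma> i else 0)" by (intro sum.cong) auto
    also have "\<dots> = (if j < n then G $$ (a, j) * \<sigma> j else 0)" by (simp add: sum.delta)
    finally show ?thesis using large[of j] kle that by auto
  qed
  have QR: "(Q' * R') $$ (a, j) = G $$ (a, j) * \<sigma> j" if "a < n" "j < k" for a j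
  proof -
    have "(Q' * R') $$ (a, j) = (\<Sum>i<k. G $$ (a, i) * (if i = j then complex_of_real (\<sigma> i) else 0))"
      using that R kle by (auto simp: scalar_prod_def atLeast0LessThan Q'_def R'_def leading_block_def intro!: sum.cong)
    also have "\<dots> = (\<Sum>i<k. if i = j then G $$ (a, i) * \<sigma> i else 0)" by (intro sum.cong) auto
    finally show ?thesis using that by (simp add: sum.delta)
  qed
  have "M = (Q' * R') * mat_adjoint V'"
  proof (rule eq_matI)
    fix a b assume "a < dim_row (Q' * R' * mat_adjoint V')" "b < dim_col (Q' * R' * mat_adjoint V')"
    then have ab: "a < n" "b < c" using c' by auto
    have "M $$ (a, b) = (\<Sum>j<c. (G * R) $$ (a, j) * cnj (V $$ (b, j)))"
      unfolding MG using ab Vc mult_carrier_mat[OF Gc Rc]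
      by (subst index_mult_mat_sum[of _ n c _ c]) (auto simp del: index_mult_mat(1))
    also have "\<dots> = (\<Sum>j<k. (G * R) $$ (a, j) * cnj (V $$ (b, j)))"
      using kle ab by (intro sum.mono_neutral_right) (auto simp: GR simp del: index_mult_mat(1))
    also have "\<dots> = (\<Sum>j<k. (Q' * R') $$ (a, j) * cnj (V' $$ (b, j)))"
      using kle ab by (intro sum.cong) (auto simp: GR QR V'_def leading_block_def simp del: index_mult_mat(1))
    also have "\<dots> = (Q' * R' * mat_adjoint V') $$ (a, b)"
      using ab c' mult_carrier_mat[OF c'(1,3)]
      by (subst index_mult_mat_sum[of _ n k _ c]) (auto simp del: index_mult_mat(1))
    finally show "M $$ (a, b) = (Q' * R' * mat_adjoint V') $$ (a, b)" .
  qed (use M c' in auto)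
  then have MQ: "M = Q' * B'" unfolding B'_def using c' by (simp add: assoc_mult_mat[of _ n k _ k _ c])
  have RD: "R' * D = 1\<^sub>m k"
  proof (rule eq_matI)
    fix i j assume "i < dim_row (1\<^sub>m k :: complex mat)" "j < dim_col (1\<^sub>m k :: complex mat)"
    then have ij: "i < k" "j < k" by auto
    have "(R' * D) $$ (i, j) = (\<Sum>l<k. R' $$ (i, l) * D $$ (l, j))"
      using ij c' by (intro index_mult_mat_sum) auto
    also have "\<dots> = (\<Sum>l<k. if l = i then (if i = j then complex_of_real (\<sigma> i) * (1 / \<sigma> i) else 0) else 0)"
      using ij kle R by (intro sum.cong) (auto simp: R'_def D_def leading_block_def)
    also have "\<dots> = (if i = j then 1 else 0)" using ij small[of i] by (auto simp: sum.delta)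
    finally show "(R' * D) $$ (i, j) = 1\<^sub>m k $$ (i, j)" using ij by simp
  qed (use c' in auto)
  define C where "C = V' * D"
  have Cc: "C \<in> carrier_mat c k" using c' by (simp add: C_def)
  have BC: "B' * C = 1\<^sub>m k"
  proof -
    have "B' * C = R' * ((mat_adjoint V' * V') * D)"
      unfolding B'_def C_def using c' 
      by (simp add: assoc_mult_mat[of _ k k _ c _ k] assoc_mult_mat[of _ k c _ k _ k])
    then show ?thesis using V1 RD c' by simp
  qed
  interpret vec_space "TYPE(complex)" n .
  \<comment> \<open>Each of \<open>M\<close> and \<open>Q'\<close> is a right multiple of the other, and \<open>Q'\<close> has full column rank \<open>k\<close>.\<close>
  have "Q' = M * C" unfolding MQ using c' Bc Cc BC by (simp add: assoc_mult_mat[of _ n k _ c _ k])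
  then have "span (set (cols M)) = span (set (cols Q'))"
    using span_cols_mult_subset[of M c C k] span_cols_mult_subset[of Q' k B' c] M c' Bc Cc MQ by auto
  then have "rank M = rank Q'" by (simp add: rank_def)
  also have "\<dots> = k" using rank_left_invertible[of Q' k "mat_adjoint Q'"] c' Q1 by simp
  finally have rk: "r = k" using r M by (simp add: mat_rank_def)
  have QB: "Q = Q'" "B = B'" using rk Vc by (simp_all add: Q_def B_def Q'_def B'_def R'_def V'_def)
  show "r \<le> n" "r \<le> c" "Q \<in> carrier_mat n r" "B \<in> carrier_mat r c" "M = Q * B"
    "mat_adjoint Q * Q = 1\<^sub>m r" "\<exists>C \<in> carrier_mat c r. B * C = 1\<^sub>m r"
    unfolding QB using rk kle c' Bc MQ Q1 BC Cc by auto
qed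

section \<open>Matrices assembled from blocks of columns\<close>

lemma mult_mat_of_cols_eq_zero:
  fixes T :: "complex mat"
  assumes T: "T \<in> carrier_mat k n" and "set ws \<subseteq> carrier_vec n" and "\<And>v. v \<in> set ws \<Longrightarrow> T *\<^sub>v v = 0\<^sub>v k"
  shows "T * mat_of_cols n ws = 0\<^sub>m k (length ws)"
proof (rule mat_col_eqI)
  fix j assume "j < dim_col (0\<^sub>m k (length ws) :: complex mat)"
  then have j: "j < length ws" by simp
  then have "col (T * mat_of_cols n ws) j = T *\<^sub>v (ws ! j)"
    using assms by (subst col_mult2[OF T mat_of_cols_carrier(1)]) (auto simp: subset_iff)
  then show "col (T * mat_of_cols n ws) j = col (0\<^sub>m k (length ws)) j" using assms j by simp
qed (use T in auto)

lemma mult_col_eq_zero: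
  fixes T :: "complex mat"
  assumes T: "T \<in> carrier_mat k n" and Q: "Q \<in> carrier_mat n c" and "T * Q = 0\<^sub>m k c" and v: "v \<in> set (cols Q)"
  shows "T *\<^sub>v v = 0\<^sub>v k"
proof -
  obtain j where j: "j < c" "v = col Q j" using v Q by (auto simp: in_set_conv_nth)
  have "T *\<^sub>v v = col (T * Q) j" using col_mult2[OF T Q j(1)] by (simp only: j(2))
  then show ?thesis using assms(3) j by simp
qed

text \<open>The first block row of a block tridiagonal congruence: only the block next to the corner survives, and
everything to its right is zero padding.\<close>

lemma mult_mat_of_cols_append:
  fixes T :: "complex mat"
  assumes T: "T \<in> carrier_mat k n" and P: "P \<in> carrier_mat n c" and ws: "set ws \<subseteq> carrier_vec n"
    and zero: "\<And>v. v \<in> set ws \<Longrightarrow> T *\<^sub>v v = 0\<^sub>v k"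
  shows "T * mat_of_cols n (cols P @ ws) = zero_pad k (c + length ws) (T * P)"
proof (rule mat_col_eqI)
  have c: "set (cols P @ ws) \<subseteq> carrier_vec n" using P ws cols_dim[of P] by auto
  fix j assume "j < dim_col (zero_pad k (c + length ws) (T * P))"
  then have j: "j < length (cols P @ ws)" using P by (simp add: zero_pad_def)
  then have nth: "(cols P @ ws) ! j \<in> carrier_vec n" using c nth_mem by blast
  have "col (T * mat_of_cols n (cols P @ ws)) j = T *\<^sub>v ((cols P @ ws) ! j)"
    using T j nth by (subst col_mult2[OF T mat_of_cols_carrier(1)]) auto
  also have "\<dots> = col (zero_pad k (c + length ws) (T * P)) j"
  proof (cases "j < c")
    case True
    then show ?thesis using T P by (intro eq_vecI) (auto simp: nth_append zero_pad_def)
  next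
    case False
    then show ?thesis using T P j zero[of "ws ! (j - c)"]
      by (intro eq_vecI) (auto simp: nth_append zero_pad_def)
  qed
  finally show "col (T * mat_of_cols n (cols P @ ws)) j = col (zero_pad k (c + length ws) (T * P)) j" .
qed (use T P in \<open>auto simp: zero_pad_def\<close>)

lemma mat_adjoint_zero_pad: "mat_adjoint (zero_pad r c M) = zero_pad c r (mat_adjoint M)"
  by (intro eq_matI) (auto simp: zero_pad_def)

lemma mat_of_cols_append_left:
  "i < n \<Longrightarrow> P \<in> carrier_mat n c \<Longrightarrow> j < c + length ws \<Longrightarrow>
   mat_of_cols n (cols P @ ws) $$ (i, j) = (if j < c then P $$ (i, j) else (mat_of_cols n ws) $$ (i, j - c))"
  by (auto simp: mat_of_cols_index nth_append)

lemma congruence_of_appended_cols: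
  fixes P Q X :: "complex mat"
  assumes P: "P \<in> carrier_mat n a" and Q: "Q \<in> carrier_mat n b" and X: "X \<in> carrier_mat n n"
  defines "M \<equiv> mat_of_cols n (cols P @ cols Q)"
  shows "mat_adjoint M * X * M =
    four_block_mat (mat_adjoint P * X * P) (mat_adjoint P * X * Q) (mat_adjoint Q * X * P) (mat_adjoint Q * X * Q)"
proof -
  have M: "M \<in> carrier_mat n (a + b)" using P Q unfolding M_def by (intro carrier_matI) auto
  have idx: "M $$ (i, j) = (if j < a then P $$ (i, j) else Q $$ (i, j - a))" if "i < n" "j < a + b" for i j
    using that P Q unfolding M_def by (subst mat_of_cols_append_left[OF _ P]) (auto simp: mat_of_cols_index)
  have entry: "(mat_adjoint A * X * B) $$ (i, j) =
      (\<Sum>l<n. (\<Sum>k<n. cnj (A $$ (k, i)) * X $$ (k, l)) * B $$ (l, j))"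
    if "A \<in> carrier_mat n r" "B \<in> carrier_mat n c" "i < r" "j < c" for A B r c i j
  proof -
    have "(mat_adjoint A * X * B) $$ (i, j) = (\<Sum>l<n. (mat_adjoint A * X) $$ (i, l) * B $$ (l, j))"
      using that X by (intro index_mult_mat_sum) auto
    also have "\<dots> = (\<Sum>l<n. (\<Sum>k<n. mat_adjoint A $$ (i, k) * X $$ (k, l)) * B $$ (l, j))"
      using that X by (intro sum.cong refl arg_cong2[of _ _ _ _ "(*)"] index_mult_mat_sum) auto
    finally show ?thesis using that by simp
  qed
  show ?thesis
  proof (rule eq_matI)
    fix i j
    assume "i < dim_row (four_block_mat (mat_adjoint P * X * P) (mat_adjoint P * X * Q) (mat_adjoint Q * X * P) (mat_adjoint Q * X * Q))"
      "j < dim_col (four_block_mat (mat_adjoint P * X * P) (mat_adjoint P * X * Q) (mat_adjoint Q * X * P) (mat_adjoint Q * X * Q))"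
    then have ij: "i < a + b" "j < a + b" using P Q by auto
    show "(mat_adjoint M * X * M) $$ (i, j) = four_block_mat (mat_adjoint P * X * P) (mat_adjoint P * X * Q) (mat_adjoint Q * X * P) (mat_adjoint Q * X * Q) $$ (i, j)"
      using P Q ij
      by (subst entry[OF M M ij], subst index_mat_four_block)
        (auto simp: entry[OF P P] entry[OF P Q] entry[OF Q P] entry[OF Q Q] idx simp del: index_mult_mat(1) assoc_mult_mat)
  qed (use M P Q X in auto)
qed

text \<open>The matrix \<open>[Q\<^sub>0 | Q\<^sub>1 | \<dots>]\<close>.\<close>

abbreviation hconcat :: "nat \<Rightarrow> complex mat list \<Rightarrow> complex mat" where
  "hconcat n Qs \<equiv> mat_of_cols n (concat (map cols Qs))"

lemma concat_cols_carrier: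
  assumes "\<And>Q. Q \<in> set Qs \<Longrightarrow> dim_row Q = n"
  shows "set (concat (map cols Qs)) \<subseteq> carrier_vec n"
  using assms cols_dim by (auto simp: subset_iff)

lemma length_concat_cols: "length (concat (map cols Qs)) = sum_list (map dim_col Qs)"
  by (simp add: length_concat comp_def)

lemma hconcat_Cons:
  assumes "\<And>P. P \<in> set Qs \<Longrightarrow> dim_row P = n"
  shows "hconcat n (Q # Qs) = mat_of_cols n (cols Q @ cols (hconcat n Qs))"
  using cols_mat_of_cols[OF concat_cols_carrier[OF assms]] by simp

lemma orthonormal_blocks_imp_isometry:
  assumes "\<And>Q. Q \<in> set Qs \<Longrightarrow> dim_row Q = n"
    and "\<And>i. i < length Qs \<Longrightarrow> mat_adjoint (Qs ! i) * Qs ! i = 1\<^sub>m (dim_col (Qs ! i))"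
    and "\<And>i k. i < k \<Longrightarrow> k < length Qs \<Longrightarrow>
      mat_adjoint (Qs ! i) * Qs ! k = 0\<^sub>m (dim_col (Qs ! i)) (dim_col (Qs ! k))"
  shows "mat_adjoint (hconcat n Qs) * hconcat n Qs = 1\<^sub>m (sum_list (map dim_col Qs))"
  using assms
proof (induction Qs)
  case Nil
  show ?case by (intro eq_matI) auto
next
  case (Cons Q Qs)
  let ?M = "hconcat n Qs" and ?s = "sum_list (map dim_col Qs)"
  obtain q where q: "dim_col Q = q" by blast
  have Q: "Q \<in> carrier_mat n q" and M: "?M \<in> carrier_mat n ?s"
    using Cons.prems(1) length_concat_cols[of Qs] q by (auto intro!: carrier_matI)
  have rows: "\<And>P. P \<in> set Qs \<Longrightarrow> dim_row P = n" using Cons.prems(1) by simp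
  have IH: "mat_adjoint ?M * ?M = 1\<^sub>m ?s"
    using Cons.prems(2)[of "Suc _"] Cons.prems(3)[of "Suc _" "Suc _"] by (intro Cons.IH rows) auto
  have QQ: "mat_adjoint Q * Q = 1\<^sub>m q" using Cons.prems(2)[of 0] q by simp
  have QT: "mat_adjoint Q \<in> carrier_mat q n" using Q by simp
  have QM: "mat_adjoint Q * ?M = 0\<^sub>m q ?s"
    unfolding length_concat_cols[symmetric]
  proof (rule mult_mat_of_cols_eq_zero[OF _ concat_cols_carrier[OF rows]])
    fix v assume "v \<in> set (concat (map cols Qs))"
    then obtain P where "P \<in> set Qs" "v \<in> set (cols P)" by auto
    then obtain k where k: "k < length Qs" "v \<in> set (cols (Qs ! k))" by (metis in_set_conv_nth)
    have zero: "mat_adjoint Q * Qs ! k = 0\<^sub>m q (dim_col (Qs ! k))"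
      using Cons.prems(3)[of 0 "Suc k"] k(1) q by simp
    have "Qs ! k \<in> carrier_mat n (dim_col (Qs ! k))" using rows[OF nth_mem[OF k(1)]] by (intro carrier_matI) simp_all
    from mult_col_eq_zero[OF QT this zero k(2)] show "mat_adjoint Q *\<^sub>v v = 0\<^sub>v q" .
  qed (rule QT)
  have MQ: "mat_adjoint ?M * Q = 0\<^sub>m ?s q"
    using arg_cong[OF QM, of mat_adjoint] Q M by (simp add: mat_adjoint_mult[of _ q n _ ?s])
  show ?case
    unfolding hconcat_Cons[OF rows]
    using congruence_of_appended_cols[OF Q M one_carrier_mat] Q M IH QQ QM MQ q cols_mat_of_cols[OF concat_cols_carrier[OF rows]]
    by (simp add: length_concat_cols)
qed

text \<open>The blocks directly below the diagonal in the congruence of \<open>X\<close> by \<open>[Q\<^sub>0 | Q\<^sub>1 | \<dots>]\<close>. For \<open>X = H\<close> these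
turn out to be the matrices \<open>B\<^sub>j\<close> of the algorithm.\<close>

definition subdiag_blocks :: "complex mat \<Rightarrow> complex mat list \<Rightarrow> complex mat list" where
  "subdiag_blocks X Qs = map2 (\<lambda>P Q. mat_adjoint Q * X * P) Qs (tl Qs)"

lemma subdiag_blocks_snoc:
  "Qs \<noteq> [] \<Longrightarrow> subdiag_blocks X (Qs @ [Q]) = subdiag_blocks X Qs @ [mat_adjoint Q * X * last Qs]"
  by (induction Qs rule: induct_list012) (auto simp: subdiag_blocks_def)

lemma length_subdiag_blocks: "length (subdiag_blocks X Qs) = length Qs - 1"
  by (simp add: subdiag_blocks_def)

lemma subdiag_blocks_nth:
  "Suc m < length Qs \<Longrightarrow> subdiag_blocks X Qs ! m = mat_adjoint (Qs ! Suc m) * X * Qs ! m"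
  by (simp add: subdiag_blocks_def nth_tl)

text \<open>Induction on the list of blocks: splitting off the first block gives a two-by-two block matrix whose lower
right corner is the congruence by the remaining blocks.\<close>

lemma congruence_block_tridiag:
  fixes X :: "complex mat"
  assumes X: "X \<in> carrier_mat n n" and "Qs \<noteq> []"
    and "\<And>Q. Q \<in> set Qs \<Longrightarrow> dim_row Q = n"
    and "\<And>i k. Suc i < k \<Longrightarrow> k < length Qs \<Longrightarrow>
      mat_adjoint (Qs ! i) * X * Qs ! k = 0\<^sub>m (dim_col (Qs ! i)) (dim_col (Qs ! k))"
    and "\<And>i k. Suc i < k \<Longrightarrow> k < length Qs \<Longrightarrow>
      mat_adjoint (Qs ! k) * X * Qs ! i = 0\<^sub>m (dim_col (Qs ! k)) (dim_col (Qs ! i))"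
  shows "mat_adjoint (hconcat n Qs) * X * hconcat n Qs =
    block_tridiag (map (\<lambda>Q. mat_adjoint Q * X * Q) Qs)
      (subdiag_blocks X Qs)
      (map2 (\<lambda>P Q. mat_adjoint P * X * Q) Qs (tl Qs))"
  using assms(2-)
proof (induction Qs rule: induct_list012)
  case (2 Q)
  then show ?case using mat_of_cols_cols[of Q] by (simp add: subdiag_blocks_def)
next
  case (3 Q P R)
  have rows: "\<And>A. A \<in> set (P # R) \<Longrightarrow> dim_row A = n" using "3.prems"(2) by simp
  let ?M = "hconcat n (P # R)" and ?s = "sum_list (map dim_col (P # R))"
  let ?r = "concat (map cols R)"
  obtain q p where q: "dim_col Q = q" and p: "dim_col P = p" by blast
  have Q: "Q \<in> carrier_mat n q" and P: "P \<in> carrier_mat n p"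
    using "3.prems"(2) q p by (auto intro!: carrier_matI)
  have M: "?M \<in> carrier_mat n ?s" using length_concat_cols[of "P # R"] by (intro carrier_matI) (simp_all only: mat_of_cols_carrier)
  have IH: "mat_adjoint ?M * X * ?M =
    block_tridiag (map (\<lambda>Q. mat_adjoint Q * X * Q) (P # R))
      (subdiag_blocks X (P # R))
      (map2 (\<lambda>P Q. mat_adjoint P * X * Q) (P # R) (tl (P # R)))"
    using "3.prems"(3,4)[of "Suc _" "Suc _"] by (intro "3.IH"(2) rows) auto
  \<comment> \<open>Used for the block row to the right of the corner and, through adjoints, for the column below it.\<close>
  have pad: "T * ?M = zero_pad q ?s (T * P)"
    if T: "T \<in> carrier_mat q n"
      and far: "\<And>k. k < length R \<Longrightarrow> T * R ! k = 0\<^sub>m q (dim_col (R ! k))" for T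
  proof -
    have "T * mat_of_cols n (cols P @ ?r) = zero_pad q (p + length ?r) (T * P)"
    proof (rule mult_mat_of_cols_append[OF T P concat_cols_carrier])
      fix v assume "v \<in> set ?r"
      then obtain A where "A \<in> set R" "v \<in> set (cols A)" by auto
      then obtain k where k: "k < length R" "v \<in> set (cols (R ! k))" by (metis in_set_conv_nth)
      have "R ! k \<in> carrier_mat n (dim_col (R ! k))" using rows[of "R ! k"] k(1) by (intro carrier_matI) simp_all
      from mult_col_eq_zero[OF T this far[OF k(1)] k(2)] show "T *\<^sub>v v = 0\<^sub>v q" .
    qed (simp add: rows)
    then show ?thesis using p length_concat_cols[of R] by simp
  qed
  have right: "mat_adjoint Q * X * ?M = zero_pad q ?s (mat_adjoint Q * X * P)"
    using "3.prems"(3)[of 0 "Suc (Suc _)"] Q X q by (intro pad) auto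
  have "mat_adjoint Q * mat_adjoint X * ?M = zero_pad q ?s (mat_adjoint Q * mat_adjoint X * P)"
  proof (rule pad)
    fix k assume k: "k < length R"
    have "R ! k \<in> carrier_mat n (dim_col (R ! k))" using rows k by (intro carrier_matI) auto
    then have "mat_adjoint Q * mat_adjoint X * R ! k = mat_adjoint (mat_adjoint (R ! k) * X * Q)"
      using mat_adjoint_sandwich[OF _ Q X] by metis
    then show "mat_adjoint Q * mat_adjoint X * R ! k = 0\<^sub>m q (dim_col (R ! k))"
      using "3.prems"(4)[of 0 "Suc (Suc k)"] k q by simp
  qed (use Q X in auto)
  from arg_cong[OF this, of mat_adjoint]
  have below: "mat_adjoint ?M * X * Q = zero_pad ?s q (mat_adjoint P * X * Q)"
    using Q P M X
    by (simp add: mat_adjoint_zero_pad mat_adjoint_sandwich[of Q n q] del: assoc_mult_mat)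
  have eq: "hconcat n (Q # P # R) = mat_of_cols n (cols Q @ cols ?M)"
    by (rule hconcat_Cons[OF rows])
  define T where "T = mat_adjoint ?M * X * ?M"
  have dim: "dim_row T = ?s" "dim_col T = ?s" using carrier_matD[OF M] by (simp_all only: T_def index_mult_mat mat_adjoint_dim)
  have main: "mat_adjoint (hconcat n (Q # P # R)) * X * hconcat n (Q # P # R) =
    four_block_mat (mat_adjoint Q * X * Q)
      (zero_pad (dim_row (mat_adjoint Q * X * Q)) (dim_col T) (mat_adjoint Q * X * P))
      (zero_pad (dim_row T) (dim_col (mat_adjoint Q * X * Q)) (mat_adjoint P * X * Q)) T"
    unfolding eq congruence_of_appended_cols[OF Q M X] right below dim
    by (simp only: T_def index_mult_mat mat_adjoint_dim q)
  show ?case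
    unfolding main using IH[folded T_def] by (simp add: Let_def subdiag_blocks_def)
qed simp

section \<open>The orbit of a vector under a unitary matrix\<close>

lemma herm_part_carrier [simp]: "U \<in> carrier_mat n n \<Longrightarrow> herm_part U \<in> carrier_mat n n"
  by (simp add: herm_part_def)

lemma antiherm_part_carrier [simp]: "U \<in> carrier_mat n n \<Longrightarrow> antiherm_part U \<in> carrier_mat n n"
  by (simp add: antiherm_part_def minus_carrier_mat)

lemma mat_adjoint_herm_part: "U \<in> carrier_mat n n \<Longrightarrow> mat_adjoint (herm_part U) = herm_part U"
  by (intro eq_matI) (auto simp: herm_part_def add.commute)

lemma mat_adjoint_antiherm_part: "U \<in> carrier_mat n n \<Longrightarrow> mat_adjoint (antiherm_part U) = - antiherm_part U"
  by (intro eq_matI) (auto simp: antiherm_part_def algebra_simps)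

lemma smult_mat_mult_vec: "(a \<cdot>\<^sub>m A) *\<^sub>v v = a \<cdot>\<^sub>v (A *\<^sub>v v)" if "dim_vec v = dim_col A"
  using that by (intro eq_vecI) (auto simp: scalar_prod_def sum_distrib_left mult.assoc)

lemma herm_part_mult_vec:
  assumes "U \<in> carrier_mat n n" "v \<in> carrier_vec n"
  shows "herm_part U *\<^sub>v v = (1/2) \<cdot>\<^sub>v (U *\<^sub>v v + mat_adjoint U *\<^sub>v v)"
  using assms by (simp add: herm_part_def smult_mat_mult_vec add_mult_distrib_mat_vec[of _ n n])

lemma antiherm_part_mult_vec:
  assumes "U \<in> carrier_mat n n" "v \<in> carrier_vec n"
  shows "antiherm_part U *\<^sub>v v = (1/2) \<cdot>\<^sub>v (U *\<^sub>v v - mat_adjoint U *\<^sub>v v)"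
  using assms by (simp add: antiherm_part_def smult_mat_mult_vec minus_mult_distrib_mat_vec[of _ n n] minus_carrier_mat)

text \<open>The starting data of the algorithm: the vector \<open>z\<close> and the unitary matrix whose parts are reduced.\<close>

locale unitary_krylov = vec_space "TYPE(complex)" n for n :: nat +
  fixes U :: "complex mat" and z :: "complex vec"
  assumes unitary: "unitary_mat n U" and z_carrier [simp]: "z \<in> carrier_vec n"
begin

abbreviation H where "H \<equiv> herm_part U"
abbreviation K where "K \<equiv> antiherm_part U"

lemma U_carrier [simp]: "U \<in> carrier_mat n n"
  using unitary by (simp add: unitary_mat_def)

lemma parts_dim [simp]: "dim_row H = n" "dim_col H = n" "dim_row K = n" "dim_col K = n"
  using carrier_matD[OF herm_part_carrier[OF U_carrier]] carrier_matD[OF antiherm_part_carrier[OF U_carrier]]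
  by simp_all

lemma Uz_carrier [simp]: "U *\<^sub>v z \<in> carrier_vec n"
  by (rule mult_mat_vec_carrier[OF U_carrier z_carrier])

text \<open>The vectors \<open>U\<^sup>k z\<close> for all integers \<open>k\<close>; negative powers of \<open>U\<close> are powers of its adjoint.\<close>

definition orbit :: "int \<Rightarrow> complex vec" where
  "orbit k = (if 0 \<le> k then ((\<lambda>v. U *\<^sub>v v) ^^ nat k) z else ((\<lambda>v. mat_adjoint U *\<^sub>v v) ^^ nat (- k)) z)"

lemma orbit_carrier [simp]: "orbit k \<in> carrier_vec n"
proof -
  have "((\<lambda>v. A *\<^sub>v v) ^^ m) z \<in> carrier_vec n" if "A \<in> carrier_mat n n" for A m
    using that by (induction m) auto
  then show ?thesis by (simp add: orbit_def)
qed

lemma orbit_image_carrier [simp]: "orbit ` I \<subseteq> carrier_vec n"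
  by auto

lemma adjoint_mult_vec_cancel: "v \<in> carrier_vec n \<Longrightarrow> mat_adjoint U *\<^sub>v (U *\<^sub>v v) = v"
  using unitary by (simp add: unitary_mat_def flip: assoc_mult_mat_vec[of _ n n _ n])

lemma mult_adjoint_vec_cancel: "v \<in> carrier_vec n \<Longrightarrow> U *\<^sub>v (mat_adjoint U *\<^sub>v v) = v"
  using unitary by (simp add: unitary_mat_def flip: assoc_mult_mat_vec[of _ n n _ n])

lemma mult_orbit: "U *\<^sub>v orbit k = orbit (k + 1)"
proof (cases "0 \<le> k")
  case True
  then have "nat (k + 1) = Suc (nat k)" by simp
  then show ?thesis using True by (simp add: orbit_def)
next
  case False
  define m where "m = nat (- k - 1)"
  have k: "k = - int (Suc m)" using False by (simp add: m_def)
  have "orbit k = mat_adjoint U *\<^sub>v orbit (k + 1)"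
    using k by (cases m) (auto simp: orbit_def nat_add_distrib Suc_nat_eq_nat_zadd1)
  then show ?thesis by (simp add: mult_adjoint_vec_cancel)
qed

lemma adjoint_mult_orbit: "mat_adjoint U *\<^sub>v orbit k = orbit (k - 1)"
  using mult_orbit[of "k - 1"] adjoint_mult_vec_cancel[of "orbit (k - 1)"] by simp

lemma orbit_0 [simp]: "orbit 0 = z" and orbit_1 [simp]: "orbit 1 = U *\<^sub>v z"
  by (simp_all add: orbit_def)

lemma herm_orbit: "H *\<^sub>v orbit k = (1/2) \<cdot>\<^sub>v (orbit (k + 1) + orbit (k - 1))"
  by (simp add: herm_part_mult_vec[of _ n] mult_orbit adjoint_mult_orbit)

lemma antiherm_orbit: "K *\<^sub>v orbit k = (1/2) \<cdot>\<^sub>v (orbit (k + 1) - orbit (k - 1))"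
  by (simp add: antiherm_part_mult_vec[of _ n] mult_orbit adjoint_mult_orbit)

text \<open>Together with the backward form below, this recovers one more orbit vector at each end of a window from one
application of the Hermitian part; it is why the recursion driven by \<open>H\<close> alone also tracks \<open>U\<close>.\<close>

lemma orbit_forward: "orbit (k + 1) = 2 \<cdot>\<^sub>v (H *\<^sub>v orbit k) - orbit (k - 1)"
  unfolding herm_orbit using orbit_carrier[of "k + 1"] orbit_carrier[of "k - 1"]
  by (intro eq_vecI) (auto simp: field_simps simp del: orbit_carrier)

lemma orbit_backward: "orbit (k - 1) = 2 \<cdot>\<^sub>v (H *\<^sub>v orbit k) - orbit (k + 1)"
  unfolding herm_orbit using orbit_carrier[of "k + 1"] orbit_carrier[of "k - 1"]
  by (intro eq_vecI) (auto simp: field_simps simp del: orbit_carrier)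

definition window :: "int \<Rightarrow> int \<Rightarrow> complex vec set" where
  "window a b = span (orbit ` {a..b})"

lemma orbit_in_window: "a \<le> k \<Longrightarrow> k \<le> b \<Longrightarrow> orbit k \<in> window a b"
  unfolding window_def using in_own_span[of "orbit ` {a..b}"] by auto

lemma window_mono: "c \<le> a \<Longrightarrow> b \<le> d \<Longrightarrow> window a b \<subseteq> window c d"
  unfolding window_def by (intro span_is_monotone) auto

lemma window_carrier: "v \<in> window a b \<Longrightarrow> v \<in> carrier_vec n"
  using span_closed_carrier[of "orbit ` {a..b}"] by (auto simp: window_def)

lemma mult_mem_window:
  assumes "A \<in> carrier_mat n n" "\<And>k. a \<le> k \<Longrightarrow> k \<le> b \<Longrightarrow> A *\<^sub>v orbit k \<in> window c d" "v \<in> window a b"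
  shows "A *\<^sub>v v \<in> window c d"
  unfolding window_def
proof (rule mult_mat_vec_mem_span[OF assms(1)])
  show "A *\<^sub>v s \<in> span (orbit ` {c..d})" if "s \<in> orbit ` {a..b}" for s
    using that assms(2) by (auto simp: window_def)
  show "v \<in> span (orbit ` {a..b})" using assms(3) by (simp only: window_def)
qed (rule orbit_image_carrier)+

lemma unitary_window: "v \<in> window a b \<Longrightarrow> U *\<^sub>v v \<in> window (a + 1) (b + 1)"
  by (rule mult_mem_window) (auto simp: mult_orbit intro: orbit_in_window)

lemma adjoint_window: "v \<in> window a b \<Longrightarrow> mat_adjoint U *\<^sub>v v \<in> window (a - 1) (b - 1)"
  by (rule mult_mem_window) (auto simp: adjoint_mult_orbit intro: orbit_in_window)

lemma herm_window: "v \<in> window a b \<Longrightarrow> H *\<^sub>v v \<in> window (a - 1) (b + 1)"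
  by (rule mult_mem_window)
    (auto simp: herm_orbit window_def intro!: smult_in_span span_add_mem orbit_in_window[unfolded window_def])

lemma antiherm_window: "v \<in> window a b \<Longrightarrow> K *\<^sub>v v \<in> window (a - 1) (b + 1)"
  by (rule mult_mem_window)
    (auto simp: antiherm_orbit window_def intro!: smult_in_span span_minus_mem orbit_in_window[unfolded window_def])

lemma orbit_in_window_forward: "orbit k \<in> window a b \<Longrightarrow> orbit (k + int t) \<in> window (a + int t) (b + int t)"
proof (induction t)
  case (Suc t)
  from unitary_window[OF Suc.IH[OF Suc.prems]] show ?case by (simp add: mult_orbit algebra_simps)
qed simp

lemma orbit_in_window_backward: "orbit k \<in> window a b \<Longrightarrow> orbit (k - int t) \<in> window (a - int t) (b - int t)"
proof (induction t)
  case (Suc t)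
  from adjoint_window[OF Suc.IH[OF Suc.prems]] show ?case by (simp add: adjoint_mult_orbit algebra_simps)
qed simp

text \<open>Fewer generators than orbit vectors force a linear relation. Its highest term \<open>orbit (a + h)\<close> lies in the
span of the earlier orbit vectors, and powers of \<open>U\<close> shift this to \<open>orbit (b + 1)\<close>; the lowest term of a
relation read from the other end is shifted down to \<open>orbit (a - 1)\<close> by powers of the adjoint.\<close>

lemma small_window_extends:
  assumes S: "finite S" "S \<subseteq> carrier_vec n" and sub: "window a b \<subseteq> span S" and card: "int (card S) < b - a + 1"
  shows "orbit (b + 1) \<in> window a b" "orbit (a - 1) \<in> window a b"
proof -
  let ?m = "nat (b - a + 1)"
  have m: "card S < ?m" using card by simp
  let ?up = "map (\<lambda>i. orbit (a + int i)) [0..<?m]"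
  have "set ?up \<subseteq> span S" using sub orbit_in_window[of a _ b] by auto
  then obtain h where h: "h < ?m" "orbit (a + int h) \<in> span (set (take h ?up))"
    using more_vectors_than_generators[OF S, of ?up] m by auto
  have "set (take h ?up) \<subseteq> orbit ` {a..a + int h - 1}" using h(1) by (auto simp: take_map)
  then have "orbit (a + int h) \<in> window a (a + int h - 1)"
    using h(2) span_is_monotone unfolding window_def by blast
  from orbit_in_window_forward[OF this, of "nat (b + 1 - a - int h)"]
  have "orbit (b + 1) \<in> window (b + 1 - int h) b" using h(1) by (auto simp: algebra_simps split: if_splits)
  moreover have "a \<le> b + 1 - int h" using h(1) by linarith
  ultimately show "orbit (b + 1) \<in> window a b" using window_mono[of a "b + 1 - int h" b b] by auto
  let ?down = "map (\<lambda>i. orbit (b - int i)) [0..<?m]"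
  have "set ?down \<subseteq> span S" using sub orbit_in_window[of a _ b] by auto
  then obtain l where l: "l < ?m" "orbit (b - int l) \<in> span (set (take l ?down))"
    using more_vectors_than_generators[OF S, of ?down] m by auto
  have "set (take l ?down) \<subseteq> orbit ` {b - int l + 1..b}" using l(1) by (auto simp: take_map)
  then have "orbit (b - int l) \<in> window (b - int l + 1) b"
    using l(2) span_is_monotone unfolding window_def by blast
  from orbit_in_window_backward[OF this, of "nat (b + 1 - a - int l)"]
  have "orbit (a - 1) \<in> window a (a - 1 + int l)" using l(1) by (auto simp: algebra_simps split: if_splits)
  moreover have "a - 1 + int l \<le> b" using l(1) by linarith
  ultimately show "orbit (a - 1) \<in> window a b" using window_mono[of a a "a - 1 + int l" b] by auto
qed

lemma herm_pow_commute: "H ^\<^sub>m Suc j = H * H ^\<^sub>m j"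
proof (induction j)
  case (Suc j)
  have "H ^\<^sub>m Suc (Suc j) = (H * H ^\<^sub>m j) * H" using Suc by simp
  also have "\<dots> = H * (H ^\<^sub>m j * H)" by (rule assoc_mult_mat[of _ n n _ n _ n]) auto
  finally show ?case by simp
qed (simp add: left_mult_one_mat[of _ n n] right_mult_one_mat[of _ n n])

lemma herm_pow_mult_vec: "v \<in> carrier_vec n \<Longrightarrow> H *\<^sub>v (H ^\<^sub>m j *\<^sub>v v) = H ^\<^sub>m Suc j *\<^sub>v v"
  unfolding herm_pow_commute by (simp add: assoc_mult_mat_vec[of _ n n _ n])

text \<open>Undoes the shift of the exponent in \<open>j - 1\<close> with \<open>j \<ge> 1\<close>.\<close>

lemma krylov_vectors_alt:
  "krylov_vectors U z = (\<Union>j. {H ^\<^sub>m j *\<^sub>v z, H ^\<^sub>m j *\<^sub>v (U *\<^sub>v z)})"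
proof -
  have "(\<exists>j. x = H ^\<^sub>m (j - 1) *\<^sub>v v \<and> 1 \<le> j) \<longleftrightarrow> (\<exists>j. x = H ^\<^sub>m j *\<^sub>v v)" for x v
    by (metis Suc_le_mono diff_Suc_1 le0 One_nat_def)
  then show ?thesis unfolding krylov_vectors_def by blast
qed

lemma krylov_vectors_carrier: "krylov_vectors U z \<subseteq> carrier_vec n"
proof -
  have "H ^\<^sub>m j *\<^sub>v v \<in> carrier_vec n" if "v \<in> carrier_vec n" for j v
    by (rule mult_mat_vec_carrier[OF _ that]) simp
  from this[OF z_carrier] this[of "U *\<^sub>v z"] show ?thesis
    unfolding krylov_vectors_alt using mult_mat_vec_carrier[OF U_carrier z_carrier] by auto
qed

lemma krylov_subset_of_invariant:
  assumes "orbit 0 \<in> W" "orbit 1 \<in> W" "\<And>v. v \<in> W \<Longrightarrow> H *\<^sub>v v \<in> W"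
  shows "krylov_vectors U z \<subseteq> W"
proof -
  have "H ^\<^sub>m j *\<^sub>v v \<in> W" if "v \<in> W" "v \<in> carrier_vec n" for j v
  proof (induction j)
    case (Suc j)
    then show ?case using assms(3) herm_pow_mult_vec[OF that(2), of j] by metis
  qed (use that in simp)
  from this[OF assms(1)] this[OF assms(2)] show ?thesis unfolding krylov_vectors_alt by auto
qed

lemma orbit_in_span_of_invariant:
  assumes S: "S \<subseteq> carrier_vec n" and 0: "orbit 0 \<in> span S" and 1: "orbit 1 \<in> span S"
    and inv: "\<And>v. v \<in> span S \<Longrightarrow> H *\<^sub>v v \<in> span S"
  shows "orbit k \<in> span S"
proof -
  have up: "orbit (int m) \<in> span S \<and> orbit (int m + 1) \<in> span S" for m
  proof (induction m)
    case (Suc m)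
    then show ?case using orbit_forward[of "int m + 1"] inv[of "orbit (int m + 1)"] span_minus_mem[OF S] smult_in_span[OF S]
      by (simp add: add.commute)
  qed (use 0 1 in auto)
  have down: "orbit (- int m) \<in> span S \<and> orbit (1 - int m) \<in> span S" for m
  proof (induction m)
    case (Suc m)
    have "2 \<cdot>\<^sub>v (H *\<^sub>v orbit (- int m)) - orbit (- int m + 1) \<in> span S"
      using Suc inv[of "orbit (- int m)"] by (intro span_minus_mem[OF S] smult_in_span[OF S]) auto
    then have "orbit (- int m - 1) \<in> span S" by (simp only: orbit_backward[of "- int m"])
    moreover have "- int (Suc m) = - int m - 1" "1 - int (Suc m) = - int m" by simp_all
    ultimately show ?case using Suc by metis
  qed (use 0 1 in auto)
  show ?thesis using up[of "nat k"] down[of "nat (- k)"] by (cases "0 \<le> k") auto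
qed

lemma orbit_in_krylov_span: "orbit k \<in> span (krylov_vectors U z)"
proof (rule orbit_in_span_of_invariant[OF krylov_vectors_carrier])
  have mem: "H ^\<^sub>m j *\<^sub>v z \<in> span (krylov_vectors U z)" "H ^\<^sub>m j *\<^sub>v (U *\<^sub>v z) \<in> span (krylov_vectors U z)" for j
    using in_own_span[of "krylov_vectors U z"] krylov_vectors_carrier by (auto simp: krylov_vectors_alt)
  show "orbit 0 \<in> span (krylov_vectors U z)" "orbit 1 \<in> span (krylov_vectors U z)" using mem[of 0] mult_mat_vec_carrier[OF U_carrier z_carrier] by auto
  show "H *\<^sub>v v \<in> span (krylov_vectors U z)" if "v \<in> span (krylov_vectors U z)" for v
  proof (rule mult_mat_vec_mem_span[OF _ krylov_vectors_carrier krylov_vectors_carrier _ that])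
    fix s assume "s \<in> krylov_vectors U z"
    then obtain j where "s = H ^\<^sub>m j *\<^sub>v z \<or> s = H ^\<^sub>m j *\<^sub>v (U *\<^sub>v z)" by (auto simp: krylov_vectors_alt)
    then show "H *\<^sub>v s \<in> span (krylov_vectors U z)"
      using herm_pow_mult_vec[of z j] herm_pow_mult_vec[of "U *\<^sub>v z" j] mem[of "Suc j"] by auto
  qed simp
qed

end

section \<open>Orthonormal blocks spanning the orbit windows\<close>

abbreviation colset :: "complex mat list \<Rightarrow> complex vec set" where
  "colset Qs \<equiv> set (concat (map cols Qs))"

lemma sum_list_le_twice:
  fixes f :: "'a \<Rightarrow> nat"
  shows "(\<And>x. x \<in> set xs \<Longrightarrow> f x \<le> 2) \<Longrightarrow> sum_list (map f xs) \<le> 2 * length xs"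
  by (induction xs) (simp, force)

text \<open>The loop invariant of the block Lanczos algorithm, stated for the list of blocks alone. The first block may be
empty, when \<open>z = 0\<close>; a later block never is, because the algorithm stops at a zero residual.\<close>

locale krylov_blocks = unitary_krylov n U z for n U z +
  fixes Qs :: "complex mat list"
  assumes nonempty: "Qs \<noteq> []"
    and block_dim_row: "i < length Qs \<Longrightarrow> dim_row (Qs ! i) = n"
    and width_le_2: "i < length Qs \<Longrightarrow> dim_col (Qs ! i) \<le> 2"
    and width_pos: "Suc i < length Qs \<Longrightarrow> dim_col (Qs ! Suc i) \<noteq> 0"
    and isometry: "i < length Qs \<Longrightarrow> mat_adjoint (Qs ! i) * Qs ! i = 1\<^sub>m (dim_col (Qs ! i))"
    and orthogonal: "i < k \<Longrightarrow> k < length Qs \<Longrightarrow>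
      mat_adjoint (Qs ! i) * Qs ! k = 0\<^sub>m (dim_col (Qs ! i)) (dim_col (Qs ! k))"
    and span_blocks: "j < length Qs \<Longrightarrow> span (colset (take (Suc j) Qs)) = window (- int j) (int j + 1)"
begin

text \<open>The number of columns under a name of its own: the rule \<open>A \<in> carrier_mat r c \<Longrightarrow> dim_col A = c\<close>, used as a
rewrite rule, would not terminate on membership facts that mention \<open>dim_col (Qs ! i)\<close> itself.\<close>

definition width :: "nat \<Rightarrow> nat" where "width i = dim_col (Qs ! i)"

lemma block_carrier [simp]: "i < length Qs \<Longrightarrow> Qs ! i \<in> carrier_mat n (width i)"
  using block_dim_row by (auto simp: width_def)

lemma orthogonal_width:
  assumes "i < length Qs" "k < length Qs" "i \<noteq> k"
  shows "mat_adjoint (Qs ! i) * Qs ! k = 0\<^sub>m (width i) (width k)"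
proof (cases "i < k")
  case True
  then show ?thesis using orthogonal assms by (simp only: width_def)
next
  case False
  then have "k < i" using assms(3) by simp
  have "mat_adjoint (Qs ! i) * Qs ! k = mat_adjoint (mat_adjoint (Qs ! k) * Qs ! i)"
    using assms by (simp add: mat_adjoint_mult[of _ "width k" n _ "width i"])
  also have "\<dots> = mat_adjoint (0\<^sub>m (width k) (width i))"
    using orthogonal[OF \<open>k < i\<close> assms(1)] by (simp only: width_def)
  finally show ?thesis by simp
qed

lemma isometry_width: "i < length Qs \<Longrightarrow> mat_adjoint (Qs ! i) * Qs ! i = 1\<^sub>m (width i)"
  using isometry by (simp only: width_def)

lemma window_Suc: "window (- int i - 1) (int i + 1 + 1) = window (- int (Suc i)) (int (Suc i) + 1)"
  by (rule arg_cong2[of _ _ _ _ window]) simp_all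

lemma colset_take_carrier: "colset (take m Qs) \<subseteq> carrier_vec n"
proof (rule concat_cols_carrier)
  fix Q assume "Q \<in> set (take m Qs)"
  then obtain i where "i < length Qs" "Q = Qs ! i" by (auto simp: in_set_conv_nth)
  then show "dim_row Q = n" using block_dim_row by simp
qed

lemma colset_carrier: "colset Qs \<subseteq> carrier_vec n"
  using colset_take_carrier[of "length Qs"] by simp

lemma cols_subset_colset_take: "i < m \<Longrightarrow> i < length Qs \<Longrightarrow> set (cols (Qs ! i)) \<subseteq> colset (take m Qs)"
  by (auto simp: set_conv_nth[of "take m Qs"] intro!: exI[of _ "Qs ! i"] exI[of _ i])

lemma colset_takeE:
  assumes "v \<in> colset (take m Qs)"
  obtains i where "i < m" "i < length Qs" "v \<in> set (cols (Qs ! i))"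
proof -
  from assms obtain Q where Q: "Q \<in> set (take m Qs)" "v \<in> set (cols Q)" by auto
  from Q(1) obtain i where "i < m" "i < length Qs" "Q = Qs ! i" by (auto simp: in_set_conv_nth)
  then show ?thesis using that Q(2) by auto
qed

lemma cols_in_window:
  assumes "i < length Qs" "v \<in> set (cols (Qs ! i))"
  shows "v \<in> window (- int i) (int i + 1)"
proof -
  have "v \<in> colset (take (Suc i) Qs)" using cols_subset_colset_take[of i "Suc i"] assms by auto
  then show ?thesis
    using in_own_span[of "colset (take (Suc i) Qs)"] colset_take_carrier span_blocks[OF assms(1)] by auto
qed

text \<open>The window of index \<open>l\<close> is spanned by the blocks up to \<open>l\<close>, and all of these are orthogonal to block \<open>k\<close>.\<close>

lemma later_block_orthogonal:
  assumes "l < k" "k < length Qs" "v \<in> window (- int l) (int l + 1)"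
  shows "mat_adjoint (Qs ! k) *\<^sub>v v = 0\<^sub>v (width k)"
proof (rule mult_mat_vec_span_eq_zero)
  show "mat_adjoint (Qs ! k) \<in> carrier_mat (width k) n" using assms by simp
  show "colset (take (Suc l) Qs) \<subseteq> carrier_vec n" by (rule colset_take_carrier)
  show "v \<in> span (colset (take (Suc l) Qs))" using assms span_blocks[of l] by simp
  fix s assume "s \<in> colset (take (Suc l) Qs)"
  then obtain i where i: "i < Suc l" "i < length Qs" "s \<in> set (cols (Qs ! i))" by (rule colset_takeE)
  show "mat_adjoint (Qs ! k) *\<^sub>v s = 0\<^sub>v (width k)"
    by (rule mult_col_eq_zero[OF _ block_carrier[OF i(2)] _ i(3)])
      (use i assms orthogonal_width[of k i] in auto)
qed

text \<open>The image of block \<open>i\<close> under \<open>X\<close> stays in the window of index \<open>i + 1\<close>, which is orthogonal to every block after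
\<open>i + 1\<close>. This applies to both parts of \<open>U\<close>, by
\<open>herm_window\<close> and \<open>antiherm_window\<close>.\<close>

lemma far_blocks_zero:
  assumes X: "X \<in> carrier_mat n n"
    and win: "\<And>v a b. v \<in> window a b \<Longrightarrow> X *\<^sub>v v \<in> window (a - 1) (b + 1)"
    and i: "Suc i < k" "k < length Qs"
  shows "mat_adjoint (Qs ! k) * X * Qs ! i = 0\<^sub>m (width k) (width i)"
proof -
  have ik: "i < length Qs" using i by simp
  have T: "mat_adjoint (Qs ! k) \<in> carrier_mat (width k) n" using i by simp
  have "mat_adjoint (Qs ! k) * X * mat_of_cols n (cols (Qs ! i)) = 0\<^sub>m (width k) (length (cols (Qs ! i)))"
  proof (rule mult_mat_of_cols_eq_zero)
    show "mat_adjoint (Qs ! k) * X \<in> carrier_mat (width k) n" using T X by simp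
    show "set (cols (Qs ! i)) \<subseteq> carrier_vec n" by (rule set_cols_carrier[OF block_carrier[OF ik]])
    fix v assume v: "v \<in> set (cols (Qs ! i))"
    have "X *\<^sub>v v \<in> window (- int (Suc i)) (int (Suc i) + 1)"
      using win[OF cols_in_window[OF ik v]] by (simp only: window_Suc)
    from later_block_orthogonal[OF i this] show "(mat_adjoint (Qs ! k) * X) *\<^sub>v v = 0\<^sub>v (width k)"
      using assoc_mult_mat_vec[OF T X, of v] window_carrier[OF cols_in_window[OF ik v]] by simp
  qed
  moreover have "mat_of_cols n (cols (Qs ! i)) = Qs ! i" using block_dim_row[OF ik] by auto
  ultimately show ?thesis using block_carrier[OF ik] by simp
qed

text \<open>A block of width at most \<open>1\<close> would leave at most \<open>2 * i + 1\<close> columns to span the \<open>2 * i + 2\<close> orbit vectors of its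
window. By \<open>small_window_extends\<close> the next window would then be no larger, and the columns of the next block would
be orthogonal to themselves.\<close>

lemma nonlast_width:
  assumes "Suc i < length Qs"
  shows "width i = 2"
proof (rule ccontr)
  assume "width i \<noteq> 2"
  have ik: "i < length Qs" using assms by simp
  then have small: "width i \<le> 1" using width_le_2[OF ik] \<open>width i \<noteq> 2\<close> by (simp add: width_def)
  let ?S = "colset (take (Suc i) Qs)"
  have "card ?S \<le> sum_list (map dim_col (take (Suc i) Qs))"
    using card_length[of "concat (map cols (take (Suc i) Qs))"] unfolding length_concat_cols .
  also have "\<dots> = sum_list (map dim_col (take i Qs)) + width i"
    using ik by (simp add: take_Suc_conv_app_nth width_def)
  also have "sum_list (map dim_col (take i Qs)) \<le> 2 * length (take i Qs)"
  proof (rule sum_list_le_twice)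
    fix Q assume "Q \<in> set (take i Qs)"
    then show "dim_col Q \<le> 2" using width_le_2 by (auto simp: in_set_conv_nth)
  qed
  finally have "int (card ?S) < (int i + 1) - (- int i) + 1" using small ik by simp
  note ext = small_window_extends[OF _ colset_take_carrier _ this]
  have ends: "orbit (int i + 2) \<in> window (- int i) (int i + 1)" "orbit (- int i - 1) \<in> window (- int i) (int i + 1)"
    using ext span_blocks[OF ik] by (simp_all add: algebra_simps)
  have sub: "window (- int (Suc i)) (int (Suc i) + 1) \<subseteq> window (- int i) (int i + 1)"
  proof -
    have "orbit k \<in> window (- int i) (int i + 1)" if "- int (Suc i) \<le> k" "k \<le> int (Suc i) + 1" for k
    proof -
      have "k = int i + 2 \<or> k = - int i - 1 \<or> (- int i \<le> k \<and> k \<le> int i + 1)" using that by auto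
      then show ?thesis using ends orbit_in_window by auto
    qed
    then show ?thesis unfolding window_def by (intro span_subsetI) auto
  qed
  let ?Q = "Qs ! Suc i"
  have "mat_adjoint ?Q * mat_of_cols n (cols ?Q) = 0\<^sub>m (width (Suc i)) (length (cols ?Q))"
  proof (rule mult_mat_of_cols_eq_zero)
    show "mat_adjoint ?Q \<in> carrier_mat (width (Suc i)) n" using assms by simp
    show "set (cols ?Q) \<subseteq> carrier_vec n" by (rule set_cols_carrier[OF block_carrier[OF assms]])
    fix v assume "v \<in> set (cols ?Q)"
    then have "v \<in> window (- int i) (int i + 1)" using cols_in_window[OF assms] sub by blast
    from later_block_orthogonal[OF _ assms this] show "mat_adjoint ?Q *\<^sub>v v = 0\<^sub>v (width (Suc i))" by simp
  qed
  moreover have "mat_of_cols n (cols ?Q) = ?Q" using block_dim_row[OF assms] by auto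
  ultimately have "1\<^sub>m (width (Suc i)) = (0\<^sub>m (width (Suc i)) (width (Suc i)) :: complex mat)"
    using isometry_width[OF assms] block_carrier[OF assms] by simp
  from arg_cong[OF this, of "\<lambda>M. M $$ (0, 0)"] show False
    using width_pos[OF assms] by (simp add: width_def)
qed

lemma total_width: "sum_list (map dim_col Qs) = 2 * (length Qs - 1) + width (length Qs - 1)"
proof -
  have "map dim_col (butlast Qs) = replicate (length Qs - 1) 2"
    using nonlast_width by (intro nth_equalityI) (auto simp: nth_butlast width_def)
  then have "sum_list (map dim_col (butlast Qs)) = 2 * (length Qs - 1)"
    by (simp add: sum_list_replicate)
  moreover have "sum_list (map dim_col Qs) = sum_list (map dim_col (butlast Qs)) + width (length Qs - 1)"
    using nonempty arg_cong[OF append_butlast_last_id[OF nonempty], of "\<lambda>xs. sum_list (map dim_col xs)"]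
    by (simp add: width_def last_conv_nth)
  ultimately show ?thesis by simp
qed

text \<open>With all earlier blocks of width \<open>2\<close>, the last one has width \<open>n\<close> minus an even number; being \<open>1\<close> or \<open>2\<close>, it is
determined by the parity of \<open>n\<close>.\<close>

lemma width_block_size:
  assumes "sum_list (map dim_col Qs) = n" "n \<ge> 1" "k < length Qs"
  shows "width k = block_size n (length Qs) k"
proof (cases "Suc k < length Qs")
  case True
  then show ?thesis using nonlast_width by (simp add: block_size_def)
next
  case False
  then have k: "k = length Qs - 1" using assms(3) by simp
  \<comment> \<open>If there is one block only, its width is \<open>n\<close>, and so it is nonzero because \<open>n \<ge> 1\<close>.\<close>
  have n: "n = 2 * k + width k" using total_width assms(1) k by simp
  have "width k \<le> 2" using width_le_2 assms(3) by (simp add: width_def)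
  moreover have "width k \<noteq> 0"
  proof (cases k)
    case (Suc m)
    then show ?thesis using width_pos[of m] assms(3) by (simp add: width_def)
  qed (use n assms(2) in simp)
  ultimately have "width k = 1 \<or> width k = 2" by linarith
  then show ?thesis using n k nonempty by (auto simp: block_size_def)
qed

lemma sandwich_carrier:
  assumes "X \<in> carrier_mat n n" "i < length Qs" "k < length Qs"
  shows "mat_adjoint (Qs ! i) * X * Qs ! k \<in> carrier_mat (width i) (width k)"
proof -
  have "mat_adjoint (Qs ! i) \<in> carrier_mat (width i) n" using assms by simp
  then show ?thesis using assms block_carrier by (blast intro: mult_carrier_mat)
qed

lemmas H_carrier = herm_part_carrier[OF U_carrier]
lemmas K_carrier = antiherm_part_carrier[OF U_carrier]

abbreviation subdiag where "subdiag \<equiv> subdiag_blocks H Qs"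

definition lst :: nat where "lst = length Qs - 1"

lemma lst: "lst < length Qs"
  using nonempty by (simp add: lst_def)

lemma last_block: "last Qs = Qs ! lst"
  using nonempty by (simp add: last_conv_nth lst_def)

text \<open>The term \<open>Q\<^bsub>j-1\<^esub> B\<^bsub>j-1\<^esub>\<^sup>H\<close> of the recursion, with \<open>B\<^bsub>j-1\<^esub>\<close> expressed through the blocks; it is zero in the
first step, where the algorithm omits it.\<close>

definition back_term :: "complex mat" where
  "back_term = (if lst = 0 then 0\<^sub>m n (width lst) else Qs ! (lst - 1) * (mat_adjoint (Qs ! (lst - 1)) * H * Qs ! lst))"

definition diag_block :: "complex mat" where
  "diag_block = mat_adjoint (Qs ! lst) * H * Qs ! lst"

lemma diag_block_carrier [simp]: "diag_block \<in> carrier_mat (width lst) (width lst)"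
  unfolding diag_block_def by (rule sandwich_carrier[OF H_carrier lst lst])

lemma back_term_carrier [simp]: "back_term \<in> carrier_mat n (width lst)"
proof (cases "lst = 0")
  case False
  then have "lst - 1 < length Qs" using lst by simp
  then have "Qs ! (lst - 1) * (mat_adjoint (Qs ! (lst - 1)) * H * Qs ! lst) \<in> carrier_mat n (width lst)"
    by (intro mult_carrier_mat[OF block_carrier sandwich_carrier[OF H_carrier _ lst]])
  then show ?thesis using False by (simp add: back_term_def)
qed (simp add: back_term_def)

lemma residual_eq: "lanczos_residual H Qs subdiag = H * Qs ! lst - Qs ! lst * diag_block - back_term"
proof (cases "lst = 0")
  case True
  then have "length (tl Qs) = 0" by (simp add: lst_def)
  then have "tl Qs = []" by (simp only: length_0_conv)
  then have "subdiag = []" by (simp add: subdiag_blocks_def)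
  moreover have "H * Qs ! lst - Qs ! lst * diag_block - 0\<^sub>m n (width lst) = H * Qs ! lst - Qs ! lst * diag_block"
    by (rule minus_zero_mat[OF minus_carrier_mat[OF mult_carrier_mat[OF block_carrier[OF lst] diag_block_carrier]]])
  ultimately show ?thesis using True by (simp add: Let_def lanczos_residual_def last_block diag_block_def back_term_def)
next
  case False
  have len: "length subdiag = lst" by (simp add: length_subdiag_blocks lst_def)
  then have "subdiag \<noteq> []" using False by auto
  then have "last subdiag = mat_adjoint (Qs ! lst) * H * Qs ! (lst - 1)"
    using False subdiag_blocks_nth[of "lst - 1" Qs H] lst by (simp add: last_conv_nth len)
  then have "mat_adjoint (last subdiag) = mat_adjoint (Qs ! (lst - 1)) * H * Qs ! lst"
    using mat_adjoint_sandwich[of "Qs ! lst" n "width lst" "Qs ! (lst - 1)" "width (lst - 1)" H] lst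
    by (simp add: mat_adjoint_herm_part[OF U_carrier])
  moreover have "last (butlast Qs) = Qs ! (lst - 1)"
  proof -
    have len': "length (butlast Qs) = lst" by (simp add: lst_def)
    then have "butlast Qs \<noteq> []" using False by (metis list.size(3))
    then have "last (butlast Qs) = butlast Qs ! (lst - 1)" by (metis last_conv_nth len')
    also have "\<dots> = Qs ! (lst - 1)" using False by (intro nth_butlast) (simp add: lst_def)
    finally show ?thesis .
  qed
  ultimately show ?thesis using False \<open>subdiag \<noteq> []\<close>
    by (simp add: lanczos_residual_def last_block diag_block_def back_term_def Let_def)
qed

abbreviation residual where "residual \<equiv> lanczos_residual H Qs subdiag"

lemma residual_carrier [simp]: "residual \<in> carrier_mat n (width lst)"
  unfolding residual_eq by (intro minus_carrier_mat back_term_carrier)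

lemma adjoint_mult_block_mult:
  assumes "i < length Qs" "k < length Qs" "M \<in> carrier_mat (width k) c"
  shows "mat_adjoint (Qs ! i) * (Qs ! k * M) = (if i = k then M else 0\<^sub>m (width i) c)"
proof -
  have "mat_adjoint (Qs ! i) * (Qs ! k * M) = (mat_adjoint (Qs ! i) * Qs ! k) * M"
    using assms by (intro assoc_mult_mat[symmetric, of _ "width i" n _ "width k" _ c]) auto
  then show ?thesis using assms isometry_width orthogonal_width by auto
qed

text \<open>The two subtracted terms remove the components of \<open>H Q\<^sub>j\<close> along \<open>Q\<^sub>j\<close> and \<open>Q\<^bsub>j-1\<^esub>\<close>. Along earlier blocks there is
nothing to remove, because \<open>H\<close> is Hermitian and maps those blocks into a window orthogonal to \<open>Q\<^sub>j\<close>.\<close>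

lemma residual_orthogonal:
  assumes i: "i < length Qs"
  shows "mat_adjoint (Qs ! i) * residual = 0\<^sub>m (width i) (width lst)"
proof -
  let ?c = "width lst" and ?T = "mat_adjoint (Qs ! i)"
  have T: "?T \<in> carrier_mat (width i) n" using i by simp
  have HQ: "H * Qs ! lst \<in> carrier_mat n ?c" and QD: "Qs ! lst * diag_block \<in> carrier_mat n ?c"
    using block_carrier[OF lst] H_carrier diag_block_carrier by (blast intro: mult_carrier_mat)+
  have "?T * residual = ?T * (H * Qs ! lst) - ?T * (Qs ! lst * diag_block) - ?T * back_term"
    unfolding residual_eq
    by (simp only: mult_minus_distrib_mat[OF T minus_carrier_mat[OF QD] back_term_carrier] mult_minus_distrib_mat[OF T HQ QD])
  also have "?T * (H * Qs ! lst) = ?T * H * Qs ! lst"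
    by (rule assoc_mult_mat[symmetric, OF T H_carrier block_carrier[OF lst]])
  also have "?T * (Qs ! lst * diag_block) = (if i = lst then diag_block else 0\<^sub>m (width i) ?c)"
    by (rule adjoint_mult_block_mult[OF i lst diag_block_carrier])
  also have "?T * back_term = (if lst \<noteq> 0 \<and> i = lst - 1 then ?T * H * Qs ! lst else 0\<^sub>m (width i) ?c)"
  proof (cases "lst = 0")
    case False
    then have l: "lst - 1 < length Qs" using lst by simp
    have "mat_adjoint (Qs ! (lst - 1)) * H * Qs ! lst \<in> carrier_mat (width (lst - 1)) ?c"
      by (rule sandwich_carrier[OF H_carrier l lst])
    from adjoint_mult_block_mult[OF i l this] show ?thesis using False by (simp add: back_term_def)
  qed (use T in \<open>simp add: back_term_def\<close>)
  finally have eq: "?T * residual = ?T * H * Qs ! lst - (if i = lst then diag_block else 0\<^sub>m (width i) ?c) -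
      (if lst \<noteq> 0 \<and> i = lst - 1 then ?T * H * Qs ! lst else 0\<^sub>m (width i) ?c)" .
  have THQ: "?T * H * Qs ! lst \<in> carrier_mat (width i) ?c"
    by (rule mult_carrier_mat[OF mult_carrier_mat[OF T H_carrier] block_carrier[OF lst]])
  consider "i = lst" | "i \<noteq> lst" "lst \<noteq> 0" "i = lst - 1" | "Suc i < lst" using i by (fastforce simp: lst_def)
  then show ?thesis
  proof cases
    case 1
    then show ?thesis unfolding eq using minus_r_inv_mat[OF diag_block_carrier]
        minus_zero_mat[OF zero_carrier_mat] by (auto simp: diag_block_def)
  next
    case 2
    then show ?thesis unfolding eq using minus_zero_mat[OF THQ] minus_r_inv_mat[OF THQ] by simp
  next
    case 3
    have "?T * H * Qs ! lst = mat_adjoint (mat_adjoint (Qs ! lst) * H * Qs ! i)"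
      using mat_adjoint_sandwich[OF block_carrier[OF lst] block_carrier[OF i] H_carrier]
      by (simp only: mat_adjoint_herm_part[OF U_carrier])
    also have "\<dots> = 0\<^sub>m (width i) ?c"
      by (simp add: far_blocks_zero[OF H_carrier _ 3 lst] herm_window del: assoc_mult_mat)
    finally show ?thesis unfolding eq using 3 minus_zero_mat[OF zero_carrier_mat, of "width i" ?c]
      by (auto simp del: assoc_mult_mat)
  qed
qed

lemma col_mult_mem_span:
  assumes "P \<in> carrier_mat n m" "M \<in> carrier_mat m c" "k < c" "set (cols P) \<subseteq> S"
  shows "col (P * M) k \<in> span S"
proof -
  have "P *\<^sub>v col M k \<in> span (set (cols P))"
    using assms(2,3) by (intro mult_mat_vec_mem_span_cols[OF assms(1)]) simp
  then show ?thesis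
    using span_is_monotone[OF assms(4)] by (simp only: col_mult2[OF assms(1-3)]) blast
qed

lemma correction_cols_in_span:
  assumes k: "k < width lst"
  shows "col (Qs ! lst * diag_block) k \<in> span (colset Qs)" "col back_term k \<in> span (colset Qs)"
proof -
  have sub: "set (cols (Qs ! j)) \<subseteq> colset Qs" if "j < length Qs" for j
    using cols_subset_colset_take[of j "length Qs"] that by auto
  show "col (Qs ! lst * diag_block) k \<in> span (colset Qs)"
    by (rule col_mult_mem_span[OF block_carrier[OF lst] diag_block_carrier k sub[OF lst]])
  show "col back_term k \<in> span (colset Qs)"
  proof (cases "lst = 0")
    case True
    then show ?thesis using span_zero_mem[OF colset_carrier] k by (simp add: back_term_def)
  next
    case False
    then have l: "lst - 1 < length Qs" using lst by simp
    have "mat_adjoint (Qs ! (lst - 1)) * H * Qs ! lst \<in> carrier_mat (width (lst - 1)) (width lst)"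
      by (rule sandwich_carrier[OF H_carrier l lst])
    from col_mult_mem_span[OF block_carrier[OF l] this k sub[OF l]]
    show ?thesis using False by (simp add: back_term_def)
  qed
qed

text \<open>On all blocks but the last, \<open>H\<close> stays in the next window; on the last one, it produces the residual up to
combinations of known columns. With \<open>T\<close> including a new block this yields growth of the window; with a zero
residual and \<open>T\<close> the present columns it yields invariance under \<open>H\<close>.\<close>

lemma herm_mult_mem_span:
  assumes T: "T \<subseteq> carrier_vec n" and sub: "colset Qs \<subseteq> T" and res: "set (cols residual) \<subseteq> span T"
    and v: "v \<in> span (colset Qs)"
  shows "H *\<^sub>v v \<in> span T"
proof (rule mult_mat_vec_mem_span[OF _ colset_carrier T _ v])
  show "H \<in> carrier_mat n n" by simp
  fix s assume "s \<in> colset Qs"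
  then obtain i where i: "i < length Qs" "s \<in> set (cols (Qs ! i))"
    using colset_takeE[of s "length Qs"] by auto
  show "H *\<^sub>v s \<in> span T"
  proof (cases "i = lst")
    case False
    then have i': "Suc i < length Qs" using i by (simp add: lst_def)
    have "H *\<^sub>v s \<in> window (- int (Suc i)) (int (Suc i) + 1)"
      using herm_window[OF cols_in_window[OF i]] by (simp only: window_Suc)
    also have "\<dots> = span (colset (take (Suc (Suc i)) Qs))" using span_blocks[OF i'] by simp
    also have "\<dots> \<subseteq> span T"
      using sub by (intro span_is_monotone) (auto dest: in_set_takeD)
    finally show ?thesis .
  next
    case True
    then obtain k where k: "k < width lst" "s = col (Qs ! lst) k"
      using i carrier_matD(2)[OF block_carrier[OF lst]] by (metis cols_length cols_nth in_set_conv_nth)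
    have HQ: "H * Qs ! lst \<in> carrier_mat n (width lst)" and QD: "Qs ! lst * diag_block \<in> carrier_mat n (width lst)"
      using block_carrier[OF lst] H_carrier diag_block_carrier by (blast intro: mult_carrier_mat)+
    have "H *\<^sub>v s = col (H * Qs ! lst) k"
      using k col_mult2[OF H_carrier block_carrier[OF lst]] by simp
    also have "\<dots> = col residual k + col (Qs ! lst * diag_block) k + col back_term k"
      unfolding residual_eq by (rule col_minus_minus_add_back[OF HQ QD back_term_carrier k(1)])
    finally have eq: "H *\<^sub>v s = col residual k + col (Qs ! lst * diag_block) k + col back_term k" .
    have "col residual k \<in> span T"
      using res k(1) carrier_matD(2)[OF residual_carrier] by (metis cols_length cols_nth nth_mem subsetD)
    moreover have "col (Qs ! lst * diag_block) k \<in> span T" "col back_term k \<in> span T"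
      using correction_cols_in_span[OF k(1)] span_is_monotone[OF sub] by auto
    ultimately show ?thesis unfolding eq by (intro span_add_mem[OF T])
  qed
qed

end

context krylov_blocks
begin

lemma residual_cols_in_window:
  "set (cols residual) \<subseteq> window (- int (Suc lst)) (int (Suc lst) + 1)"
proof
  fix v assume "v \<in> set (cols residual)"
  then obtain k where k: "k < width lst" "v = col residual k"
    using carrier_matD(2)[OF residual_carrier] by (metis cols_length cols_nth in_set_conv_nth)
  have HQ: "H * Qs ! lst \<in> carrier_mat n (width lst)" and QD: "Qs ! lst * diag_block \<in> carrier_mat n (width lst)"
    using block_carrier[OF lst] H_carrier diag_block_carrier by (blast intro: mult_carrier_mat)+
  let ?W = "window (- int (Suc lst)) (int (Suc lst) + 1)"
  have "span (colset Qs) = window (- int lst) (int lst + 1)"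
    using span_blocks[OF lst] lst by (simp add: lst_def)
  then have sub: "span (colset Qs) \<subseteq> ?W" using window_mono by simp
  have v: "v = col (H * Qs ! lst) k - col (Qs ! lst * diag_block) k - col back_term k"
    unfolding k(2) residual_eq by (rule col_minus_minus[OF HQ QD back_term_carrier k(1)])
  have "col (Qs ! lst) k \<in> set (cols (Qs ! lst))"
    using k(1) carrier_matD(2)[OF block_carrier[OF lst]] by (metis cols_length cols_nth nth_mem)
  from herm_window[OF cols_in_window[OF lst this]]
  have "col (H * Qs ! lst) k \<in> ?W"
    using k(1) col_mult2[OF H_carrier block_carrier[OF lst]] by (simp only: window_Suc)
  then show "v \<in> ?W"
    unfolding v using correction_cols_in_span[OF k(1)] sub
    unfolding window_def by (intro span_minus_mem[OF orbit_image_carrier]) auto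
qed

text \<open>Multiplying \<open>Q B = H Q\<^sub>j - \<dots>\<close> by the adjoint of \<open>Q\<close> kills the subtracted terms, so the factor \<open>B\<close> computed by
the algorithm is the subdiagonal block of the congruence.\<close>

lemma next_block_subdiag:
  assumes Q: "Q \<in> carrier_mat n r" and B: "B \<in> carrier_mat r (width lst)" and W: "residual = Q * B"
    and iso: "mat_adjoint Q * Q = 1\<^sub>m r" and orth: "\<And>i. i < length Qs \<Longrightarrow> mat_adjoint Q * Qs ! i = 0\<^sub>m r (width i)"
  shows "mat_adjoint Q * H * last Qs = B"
proof -
  have T: "mat_adjoint Q \<in> carrier_mat r n" using Q by simp
  have HQ: "H * Qs ! lst \<in> carrier_mat n (width lst)" and QD: "Qs ! lst * diag_block \<in> carrier_mat n (width lst)"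
    using block_carrier[OF lst] H_carrier diag_block_carrier by (blast intro: mult_carrier_mat)+
  have zero: "mat_adjoint Q * (Qs ! i * M) = 0\<^sub>m r c" if "i < length Qs" "M \<in> carrier_mat (width i) c" for i M c
    using assoc_mult_mat[OF T block_carrier[OF that(1)] that(2)] orth[OF that(1)] that(2) by simp
  have zero_diag: "mat_adjoint Q * (Qs ! lst * diag_block) = 0\<^sub>m r (width lst)"
    by (rule zero[OF lst diag_block_carrier])
  have zero_back: "mat_adjoint Q * back_term = 0\<^sub>m r (width lst)"
  proof (cases "lst = 0")
    case False
    then have l: "lst - 1 < length Qs" using lst by simp
    show ?thesis using zero[OF l sandwich_carrier[OF H_carrier l lst]] False by (simp add: back_term_def)
  qed (use T in \<open>simp add: back_term_def\<close>)
  have THQ: "mat_adjoint Q * (H * Qs ! lst) \<in> carrier_mat r (width lst)"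
    by (rule mult_carrier_mat[OF T HQ])
  have "B = (mat_adjoint Q * Q) * B" using iso B by simp
  also have "\<dots> = mat_adjoint Q * residual" unfolding W by (rule assoc_mult_mat[OF T Q B])
  also have "\<dots> = mat_adjoint Q * (H * Qs ! lst) - mat_adjoint Q * (Qs ! lst * diag_block) - mat_adjoint Q * back_term"
    unfolding residual_eq
    by (simp only: mult_minus_distrib_mat[OF T minus_carrier_mat[OF QD] back_term_carrier] mult_minus_distrib_mat[OF T HQ QD])
  also have "\<dots> = mat_adjoint Q * (H * Qs ! lst)"
    unfolding zero_diag zero_back by (simp only: minus_zero_mat[OF THQ])
  also have "\<dots> = mat_adjoint Q * H * Qs ! lst"
    by (rule assoc_mult_mat[symmetric, OF T H_carrier block_carrier[OF lst]])
  finally show ?thesis by (simp only: last_block)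
qed

text \<open>One step of the algorithm preserves the invariant. As \<open>Q\<close> is a right multiple of the residual, it inherits the
orthogonality to the earlier blocks and the inclusion in the larger window. The larger window is reached because
the forward and backward recurrences of the orbit need just one application of \<open>H\<close>.\<close>

lemma next_block:
  assumes Q: "Q \<in> carrier_mat n r" and B: "B \<in> carrier_mat r (width lst)" and W: "residual = Q * B"
    and iso: "mat_adjoint Q * Q = 1\<^sub>m r" and C: "C \<in> carrier_mat (width lst) r" "B * C = 1\<^sub>m r"
    and r: "r \<noteq> 0" "r \<le> width lst"
  shows "krylov_blocks n U z (Qs @ [Q])" "mat_adjoint Q * H * last Qs = B"
proof -
  have QWC: "Q = residual * C" unfolding W using assoc_mult_mat[OF Q B C(1)] C(2) Q by simp
  have orth: "mat_adjoint (Qs ! i) * Q = 0\<^sub>m (width i) r" if i: "i < length Qs" for i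
  proof -
    have "mat_adjoint (Qs ! i) \<in> carrier_mat (width i) n" using i by simp
    from assoc_mult_mat[OF this residual_carrier C(1)]
    have "mat_adjoint (Qs ! i) * Q = (mat_adjoint (Qs ! i) * residual) * C" by (simp only: QWC)
    then show ?thesis using residual_orthogonal[OF i] C by simp
  qed
  have orth': "mat_adjoint Q * Qs ! i = 0\<^sub>m r (width i)" if i: "i < length Qs" for i
  proof -
    have "mat_adjoint (Qs ! i) \<in> carrier_mat (width i) n" using i by simp
    from mat_adjoint_mult[OF this Q] show ?thesis by (simp add: orth[OF i])
  qed
  show "mat_adjoint Q * H * last Qs = B" by (rule next_block_subdiag[OF Q B W iso orth'])
  let ?S = "colset Qs" and ?S' = "colset (Qs @ [Q])"
  let ?W = "window (- int (Suc lst)) (int (Suc lst) + 1)"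
  have len: "length Qs = Suc lst" using lst by (simp add: lst_def)
  have span_S: "span ?S = window (- int lst) (int lst + 1)"
    using span_blocks[OF lst] len by simp
  have S': "?S' = ?S \<union> set (cols Q)" by simp
  have S'c: "?S' \<subseteq> carrier_vec n" using colset_carrier set_cols_carrier[OF Q] by simp
  have "span ?S' = ?W"
  proof
    have "?S \<subseteq> ?W"
      using in_own_span[of ?S] colset_carrier span_S window_mono[of "- int (Suc lst)" "- int lst" "int lst + 1" "int (Suc lst) + 1"]
      by auto
    moreover have "set (cols Q) \<subseteq> ?W"
    proof -
      have "set (cols Q) \<subseteq> span (set (cols Q))" using in_own_span[of "set (cols Q)"] set_cols_carrier[OF Q] by simp
      also have "\<dots> \<subseteq> span (set (cols residual))"
        using span_cols_mult_subset[OF residual_carrier C(1)] by (simp only: QWC[symmetric])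
      also have "\<dots> \<subseteq> ?W"
        using residual_cols_in_window unfolding window_def by (intro span_subsetI[OF orbit_image_carrier])
      finally show ?thesis .
    qed
    ultimately show "span ?S' \<subseteq> ?W"
      unfolding window_def S' by (intro span_subsetI[OF orbit_image_carrier]) auto
    have res: "set (cols residual) \<subseteq> span ?S'"
    proof
      fix v assume "v \<in> set (cols residual)"
      then obtain k where k: "k < width lst" "v = col residual k"
        using carrier_matD(2)[OF residual_carrier] by (metis cols_length cols_nth in_set_conv_nth)
      show "v \<in> span ?S'" unfolding k(2) W by (rule col_mult_mem_span[OF Q B k(1)]) simp
    qed
    have step: "H *\<^sub>v v \<in> span ?S'" if "v \<in> span ?S" for v
      using herm_mult_mem_span[OF S'c _ res that] by simp
    have old: "orbit k \<in> span ?S'" if "- int lst \<le> k" "k \<le> int lst + 1" for k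
      using orbit_in_window[OF that] span_S span_is_monotone[of ?S ?S'] by auto
    have ends: "orbit (- int lst) \<in> span ?S" "orbit (int lst + 1) \<in> span ?S"
      unfolding span_S by (auto intro: orbit_in_window)
    have "orbit (int lst + 1 + 1) \<in> span ?S'"
      unfolding orbit_forward[of "int lst + 1"] using step[OF ends(2)] old[of "int lst"]
      by (intro span_minus_mem[OF S'c] smult_in_span[OF S'c]) auto
    moreover have "orbit (- int lst - 1) \<in> span ?S'"
      unfolding orbit_backward[of "- int lst"] using step[OF ends(1)] old[of "- int lst + 1"]
      by (intro span_minus_mem[OF S'c] smult_in_span[OF S'c]) auto
    ultimately have "orbit k \<in> span ?S'" if "- int (Suc lst) \<le> k" "k \<le> int (Suc lst) + 1" for k
    proof -
      have "k = int lst + 1 + 1 \<or> k = - int lst - 1 \<or> (- int lst \<le> k \<and> k \<le> int lst + 1)" using that by auto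
      then show ?thesis
        using old \<open>orbit (int lst + 1 + 1) \<in> span ?S'\<close> \<open>orbit (- int lst - 1) \<in> span ?S'\<close> by metis
    qed
    then show "?W \<subseteq> span ?S'" unfolding window_def by (intro span_subsetI[OF S'c]) auto
  qed
  note span_new = this
  have r2: "r \<le> 2" using r(2) width_le_2[OF lst] by (simp add: width_def)
  show "krylov_blocks n U z (Qs @ [Q])"
  proof unfold_locales
    fix i j k
    show "Qs @ [Q] \<noteq> []" by simp
    show "i < length (Qs @ [Q]) \<Longrightarrow> dim_row ((Qs @ [Q]) ! i) = n"
      using Q block_dim_row[of i] by (cases "i < length Qs") (auto simp: nth_append less_Suc_eq)
    show "i < length (Qs @ [Q]) \<Longrightarrow> dim_col ((Qs @ [Q]) ! i) \<le> 2"
      using Q r2 width_le_2[of i] by (cases "i < length Qs") (auto simp: nth_append less_Suc_eq)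
    show "Suc i < length (Qs @ [Q]) \<Longrightarrow> dim_col ((Qs @ [Q]) ! Suc i) \<noteq> 0"
      using Q r width_pos[of i] by (cases "Suc i < length Qs") (auto simp: nth_append less_Suc_eq)
    show "i < length (Qs @ [Q]) \<Longrightarrow> mat_adjoint ((Qs @ [Q]) ! i) * (Qs @ [Q]) ! i = 1\<^sub>m (dim_col ((Qs @ [Q]) ! i))"
      using Q iso isometry[of i] by (cases "i < length Qs") (auto simp: nth_append less_Suc_eq)
    show "i < k \<Longrightarrow> k < length (Qs @ [Q]) \<Longrightarrow> mat_adjoint ((Qs @ [Q]) ! i) * (Qs @ [Q]) ! k =
        0\<^sub>m (dim_col ((Qs @ [Q]) ! i)) (dim_col ((Qs @ [Q]) ! k))"
      using Q orth[of i] orthogonal[of i k]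
      by (cases "k < length Qs") (auto simp: nth_append less_Suc_eq width_def)
    show "span (colset (take (Suc j) (Qs @ [Q]))) = window (- int j) (int j + 1)" if "j < length (Qs @ [Q])"
    proof (cases "j < length Qs")
      case True
      then show ?thesis using span_blocks[OF True] by simp
    next
      case False
      then have j: "j = Suc lst" using that len by simp
      then have "take (Suc j) (Qs @ [Q]) = Qs @ [Q]" using len by simp
      then show ?thesis using span_new by (simp only: j)
    qed
  qed
qed

lemma span_colset: "span (colset Qs) = window (- int lst) (int lst + 1)"
  using span_blocks[OF lst] lst by (simp add: lst_def)

lemma zero_residual_imp_krylov_in_span:
  assumes "residual = 0\<^sub>m n (width lst)"
  shows "krylov_vectors U z \<subseteq> span (colset Qs)"
proof (rule krylov_subset_of_invariant)
  show "orbit 0 \<in> span (colset Qs)" "orbit 1 \<in> span (colset Qs)"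
    unfolding span_colset by (rule orbit_in_window; simp)+
  have "set (cols residual) \<subseteq> span (colset Qs)"
    unfolding assms using span_zero_mem[OF colset_carrier] by (auto simp: cols_def)
  from herm_mult_mem_span[OF colset_carrier subset_refl this]
  show "H *\<^sub>v v \<in> span (colset Qs)" if "v \<in> span (colset Qs)" for v using that by simp
qed

text \<open>The columns found so far span a space that contains every Krylov vector, but they are fewer than \<open>n\<close>.\<close>

lemma early_imp_not_spanning:
  assumes "residual = 0\<^sub>m n (width lst)" and small: "sum_list (map dim_col Qs) < n"
  shows "\<not> spans_space n (krylov_vectors U z)"
proof
  assume "spans_space n (krylov_vectors U z)"
  then have "carrier_vec n = span (krylov_vectors U z)" by (simp add: spans_space_def)
  also have "\<dots> \<subseteq> span (colset Qs)"
    by (rule span_subsetI[OF colset_carrier zero_residual_imp_krylov_in_span[OF assms(1)]])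
  finally have "gen_set (colset Qs)" using span_closed_carrier[OF colset_carrier] by auto
  then have "n \<le> card (colset Qs)"
    using gen_ge_dim[of "colset Qs"] colset_carrier by (simp add: dim_is_n)
  also have "\<dots> \<le> sum_list (map dim_col Qs)"
    using card_length[of "concat (map cols Qs)"] unfolding length_concat_cols .
  finally show False using small by simp
qed

lemma hconcat_unitary:
  assumes total: "sum_list (map dim_col Qs) = n"
  shows "unitary_mat n (hconcat n Qs)"
proof -
  have c: "hconcat n Qs \<in> carrier_mat n n"
    using mat_of_cols_carrier(1)[of n "concat (map cols Qs)"] unfolding length_concat_cols total .
  have "mat_adjoint (hconcat n Qs) * hconcat n Qs = 1\<^sub>m (sum_list (map dim_col Qs))"
    by (rule orthonormal_blocks_imp_isometry)
      (use block_dim_row isometry orthogonal in \<open>auto simp: in_set_conv_nth\<close>)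
  then have "mat_adjoint (hconcat n Qs) * hconcat n Qs = 1\<^sub>m n" by (simp only: total)
  moreover from mat_mult_left_right_inverse[OF _ c this]
  have "hconcat n Qs * mat_adjoint (hconcat n Qs) = 1\<^sub>m n" using c by simp
  ultimately show ?thesis using c by (simp add: unitary_mat_def)
qed

text \<open>The columns of a unitary matrix span the whole space; here they lie in a window of the orbit, and every orbit
vector is in the span of the Krylov vectors.\<close>

lemma completed_imp_spanning:
  assumes total: "sum_list (map dim_col Qs) = n"
  shows "spans_space n (krylov_vectors U z)"
proof -
  let ?P = "hconcat n Qs"
  have P: "?P \<in> carrier_mat n n" and inv: "?P * mat_adjoint ?P = 1\<^sub>m n"
    using hconcat_unitary[OF total] by (auto simp: unitary_mat_def)
  have "carrier_vec n \<subseteq> span (colset Qs)"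
  proof
    fix v :: "complex vec" assume v: "v \<in> carrier_vec n"
    have Pa: "mat_adjoint ?P \<in> carrier_mat n n" using P by simp
    have "v = ?P *\<^sub>v (mat_adjoint ?P *\<^sub>v v)"
      using assoc_mult_mat_vec[OF P Pa v] v by (simp only: inv one_mult_mat_vec)
    also have "\<dots> \<in> span (set (cols ?P))"
      by (rule mult_mat_vec_mem_span_cols[OF P mult_mat_vec_carrier[OF Pa v]])
    also have "cols ?P = concat (map cols Qs)" by (rule cols_mat_of_cols[OF colset_carrier])
    finally show "v \<in> span (colset Qs)" .
  qed
  also have "\<dots> \<subseteq> span (krylov_vectors U z)"
    unfolding span_colset window_def using orbit_in_krylov_span
    by (intro span_subsetI[OF krylov_vectors_carrier]) auto
  finally show ?thesis
    using span_closed_carrier[OF krylov_vectors_carrier] by (auto simp: spans_space_def)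
qed

text \<open>The sign \<open>s\<close> treats the Hermitian part (\<open>s = 1\<close>) and the skew-Hermitian part (\<open>s = -1\<close>) at once: passing to adjoints
exchanges the blocks above and below the diagonal, up to the factor \<open>s\<close>.\<close>

lemma congruence_tridiagonal:
  assumes X: "X \<in> carrier_mat n n" and s: "s = 1 \<or> s = -1" and adj: "mat_adjoint X = s \<cdot>\<^sub>m X"
    and win: "\<And>v a b. v \<in> window a b \<Longrightarrow> X *\<^sub>v v \<in> window (a - 1) (b + 1)"
  shows "mat_adjoint (hconcat n Qs) * X * hconcat n Qs =
    block_tridiag (map (\<lambda>Q. mat_adjoint Q * X * Q) Qs) (subdiag_blocks X Qs)
      (map (\<lambda>B. s \<cdot>\<^sub>m mat_adjoint B) (subdiag_blocks X Qs))"
proof -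
  have flip: "mat_adjoint (Qs ! i) * X * Qs ! k = s \<cdot>\<^sub>m mat_adjoint (mat_adjoint (Qs ! k) * X * Qs ! i)"
    if "i < length Qs" "k < length Qs" for i k
  proof -
    have M: "mat_adjoint (Qs ! i) * X * Qs ! k \<in> carrier_mat (width i) (width k)"
      by (rule sandwich_carrier[OF X that])
    have "s * s = 1" using s by auto
    have "mat_adjoint (mat_adjoint (Qs ! k) * X * Qs ! i) = mat_adjoint (Qs ! i) * (s \<cdot>\<^sub>m X) * Qs ! k"
      using mat_adjoint_sandwich[OF block_carrier[OF that(2)] block_carrier[OF that(1)] X] by (simp only: adj)
    also have "\<dots> = s \<cdot>\<^sub>m (mat_adjoint (Qs ! i) * X * Qs ! k)"
    proof -
      have T: "mat_adjoint (Qs ! i) \<in> carrier_mat (width i) n" using that by simp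
      show ?thesis
        by (simp only: mult_smult_distrib[OF T X] mult_smult_assoc_mat[OF mult_carrier_mat[OF T X] block_carrier[OF that(2)]])
    qed
    finally show ?thesis using M \<open>s * s = 1\<close> by (simp only:) (intro eq_matI, auto simp flip: mult.assoc)
  qed
  have below: "mat_adjoint (Qs ! k) * X * Qs ! i = 0\<^sub>m (width k) (width i)" if "Suc i < k" "k < length Qs" for i k
    by (rule far_blocks_zero[OF X win that])
  have above: "mat_adjoint (Qs ! i) * X * Qs ! k = 0\<^sub>m (width i) (width k)" if "Suc i < k" "k < length Qs" for i k
  proof -
    have "i < length Qs" using that by simp
    from flip[OF this that(2)] show ?thesis unfolding below[OF that] by (auto simp: eq_matI)
  qed
  have "mat_adjoint (hconcat n Qs) * X * hconcat n Qs =
    block_tridiag (map (\<lambda>Q. mat_adjoint Q * X * Q) Qs) (subdiag_blocks X Qs)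
      (map2 (\<lambda>P Q. mat_adjoint P * X * Q) Qs (tl Qs))"
    using above below block_dim_row unfolding width_def
    by (intro congruence_block_tridiag[OF X nonempty]) (auto simp: in_set_conv_nth)
  also have "map2 (\<lambda>P Q. mat_adjoint P * X * Q) Qs (tl Qs) =
      map (\<lambda>B. s \<cdot>\<^sub>m mat_adjoint B) (subdiag_blocks X Qs)"
  proof (rule nth_equalityI)
    fix m assume "m < length (map2 (\<lambda>P Q. mat_adjoint P * X * Q) Qs (tl Qs))"
    then have m: "Suc m < length Qs" by simp
    then have "map2 (\<lambda>P Q. mat_adjoint P * X * Q) Qs (tl Qs) ! m = mat_adjoint (Qs ! m) * X * Qs ! Suc m"
      by (simp add: nth_tl del: assoc_mult_mat)
    also have "\<dots> = s \<cdot>\<^sub>m mat_adjoint (subdiag_blocks X Qs ! m)"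
      unfolding subdiag_blocks_nth[OF m] using m by (intro flip) auto
    also have "\<dots> = map (\<lambda>B. s \<cdot>\<^sub>m mat_adjoint B) (subdiag_blocks X Qs) ! m"
      using m by (simp add: length_subdiag_blocks)
    finally show "map2 (\<lambda>P Q. mat_adjoint P * X * Q) Qs (tl Qs) ! m =
        map (\<lambda>B. s \<cdot>\<^sub>m mat_adjoint B) (subdiag_blocks X Qs) ! m" .
  qed (simp add: length_subdiag_blocks)
  finally show ?thesis .
qed

lemma blocks_of_size_congruence:
  assumes X: "X \<in> carrier_mat n n" and total: "sum_list (map dim_col Qs) = n" and n: "n \<ge> 1"
  shows "blocks_of_size n (length Qs) (map (\<lambda>Q. mat_adjoint Q * X * Q) Qs) (subdiag_blocks X Qs)"
  unfolding blocks_of_size_def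
proof (intro conjI allI impI)
  show "length (map (\<lambda>Q. mat_adjoint Q * X * Q) Qs) = length Qs" by simp
  show "Suc (length (subdiag_blocks X Qs)) = length Qs" using lst by (simp add: length_subdiag_blocks)
  show "map (\<lambda>Q. mat_adjoint Q * X * Q) Qs ! k \<in> carrier_mat (block_size n (length Qs) k) (block_size n (length Qs) k)"
    if "k < length Qs" for k
    using sandwich_carrier[OF X that that] width_block_size[OF total n that] that by simp
  show "subdiag_blocks X Qs ! k \<in> carrier_mat (block_size n (length Qs) (Suc k)) (block_size n (length Qs) k)"
    if "Suc k < length Qs" for k
    using sandwich_carrier[OF X that, of k] width_block_size[OF total n, of k] width_block_size[OF total n that]
      subdiag_blocks_nth[OF that, of X] that by simp
qed

end

section \<open>Runs of the block Lanczos algorithm\<close>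

context unitary_krylov
begin

text \<open>The orthonormal bases depend on the chosen singular value decompositions, but every choice factors the residual
as required by \<open>next_block\<close>. The columns of the initial block span the window from \<open>0\<close> to \<open>1\<close>.\<close>

lemma lanczos_state_blocks:
  assumes "lanczos_state n H (mat_of_cols n [z, U *\<^sub>v z]) Qs As Bs"
  shows "krylov_blocks n U z Qs \<and> As = map (\<lambda>Q. mat_adjoint Q * H * Q) (butlast Qs) \<and> Bs = subdiag_blocks H Qs"
  using assms
proof induction
  case (init G R V)
  let ?D = "mat_of_cols n [z, U *\<^sub>v z]"
  let ?r = "mat_rank ?D"
  let ?Q = "leading_block G n ?r"
  have D: "?D \<in> carrier_mat n 2" using mat_of_cols_carrier(1)[of n "[z, U *\<^sub>v z]"] by (simp add: numeral_2_eq_2)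
  note svd = svd_factorization[OF D init refl]
  obtain C where C: "C \<in> carrier_mat 2 ?r"
    "(leading_block R ?r ?r * mat_adjoint (leading_block V (dim_row V) ?r)) * C = 1\<^sub>m ?r"
    using svd(7) by blast
  define Q where "Q = ?Q"
  define r where "r = ?r"
  define B where "B = leading_block R ?r ?r * mat_adjoint (leading_block V (dim_row V) ?r)"
  have f: "r \<le> 2" "Q \<in> carrier_mat n r" "B \<in> carrier_mat r 2" "?D = Q * B" "mat_adjoint Q * Q = 1\<^sub>m r"
    "C \<in> carrier_mat 2 r" "B * C = 1\<^sub>m r"
    using svd(2-6) C by (simp_all only: Q_def r_def B_def)
  have QDC: "Q = ?D * C" unfolding f(4) using assoc_mult_mat[OF f(2,3,6)] f(7,2) by simp
  have "span (set (cols Q)) = span (set (cols ?D))"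
    using span_cols_mult_subset[OF D f(6)] span_cols_mult_subset[OF f(2,3)] by (simp only: f(4)[symmetric] QDC[symmetric]) 
  also have "cols ?D = [z, U *\<^sub>v z]" by (rule cols_mat_of_cols) simp
  also have "set [z, U *\<^sub>v z] = orbit ` {0..1}"
  proof -
    have "{0..1::int} = {0, 1}" by auto
    then show ?thesis by simp
  qed
  finally have sp: "span (set (cols Q)) = window 0 1" by (simp only: window_def)
  have "krylov_blocks n U z [Q]"
    by unfold_locales (use f sp in auto)
  then show ?case by (simp add: Q_def[symmetric] subdiag_blocks_def)
next
  case (step Qs As Bs G R V r)
  interpret krylov_blocks n U z Qs using step.IH by simp
  have Bs: "Bs = subdiag" using step.IH by simp
  note svd = svd_factorization[OF residual_carrier step.hyps(3)[unfolded Bs] step.hyps(4)[unfolded Bs]]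
  obtain C where C: "C \<in> carrier_mat (width lst) r"
    "(leading_block R r r * mat_adjoint (leading_block V (dim_row V) r)) * C = 1\<^sub>m r"
    using svd(7) by blast
  note nb = next_block[OF svd(3,4,5,6) C step.hyps(5) svd(2)]
  have "map (\<lambda>Q. mat_adjoint Q * H * Q) (butlast Qs) @ [mat_adjoint (last Qs) * H * last Qs] =
      map (\<lambda>Q. mat_adjoint Q * H * Q) (butlast (Qs @ [leading_block G n r]))"
    using arg_cong[OF append_butlast_last_id[OF nonempty], of "map (\<lambda>Q. mat_adjoint Q * H * Q)"] by simp
  then show ?case using nb step.IH subdiag_blocks_snoc[OF nonempty, of H] by simp
qed

end

theorem theorem2:
  fixes n :: nat and U :: "complex mat" and z :: "complex vec" and out :: lanczos_outcome
  assumes "n \<ge> 1"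
    and "unitary_mat n U"
    and "z \<in> carrier_vec n"
    and "block_lanczos n (herm_part U) (mat_of_cols n [z, U *\<^sub>v z]) out"
  shows "(spans_space n (krylov_vectors U z) \<longleftrightarrow> out \<noteq> Early_Termination) \<and>
    (spans_space n (krylov_vectors U z) \<longrightarrow>
      (\<exists>Q As Bs p. out = Completed Q As Bs \<and>
        unitary_mat n Q \<and>
        blocks_of_size n p As Bs \<and>
        mat_adjoint Q * herm_part U * Q = block_tridiag As Bs (map mat_adjoint Bs) \<and>
        (\<exists>As' Bs'. blocks_of_size n p As' Bs' \<and>
          mat_adjoint Q * antiherm_part U * Q =
            block_tridiag As' Bs' (map (\<lambda>B. - mat_adjoint B) Bs'))))"
proof -
  interpret unitary_krylov n U z by unfold_locales (fact assms(2,3))+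
  from assms(4) show ?thesis
  proof cases
    case (early Qs As Bs)
    interpret krylov_blocks n U z Qs using lanczos_state_blocks[OF early(2)] by simp
    have Bs: "Bs = subdiag" using lanczos_state_blocks[OF early(2)] by simp
    have "rank residual = 0"
      using early(4) carrier_matD(1)[OF residual_carrier] by (simp add: mat_rank_def Bs)
    then have "residual = 0\<^sub>m n (width lst)" by (rule rank_zero_imp_zero[OF residual_carrier])
    from early_imp_not_spanning[OF this early(3)] show ?thesis using early(1) by simp
  next
    case (completed Qs As Bs)
    interpret krylov_blocks n U z Qs using lanczos_state_blocks[OF completed(2)] by simp
    let ?P = "hconcat n Qs"
    note total = completed(3)
    have As: "As @ [mat_adjoint (last Qs) * H * last Qs] = map (\<lambda>Q. mat_adjoint Q * H * Q) Qs"
      using lanczos_state_blocks[OF completed(2)]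
        arg_cong[OF append_butlast_last_id[OF nonempty], of "map (\<lambda>Q. mat_adjoint Q * H * Q)"] by simp
    have Bs: "Bs = subdiag" using lanczos_state_blocks[OF completed(2)] by simp
    have out: "out = Completed ?P (map (\<lambda>Q. mat_adjoint Q * H * Q) Qs) subdiag"
      using completed(1) by (simp only: As Bs)
    have one: "1 \<cdot>\<^sub>m M = M" and minus_one: "(-1) \<cdot>\<^sub>m M = - M" for M :: "complex mat"
      by (intro eq_matI; simp)+
    have "mat_adjoint ?P * H * ?P = block_tridiag (map (\<lambda>Q. mat_adjoint Q * H * Q) Qs) subdiag (map mat_adjoint subdiag)"
      using congruence_tridiagonal[of H 1] H_carrier herm_window mat_adjoint_herm_part[OF U_carrier]
      by (simp add: one del: assoc_mult_mat)
    moreover have "mat_adjoint ?P * K * ?P = block_tridiag (map (\<lambda>Q. mat_adjoint Q * K * Q) Qs)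
        (subdiag_blocks K Qs) (map (\<lambda>B. - mat_adjoint B) (subdiag_blocks K Qs))"
      using congruence_tridiagonal[of K "-1"] K_carrier antiherm_window mat_adjoint_antiherm_part[OF U_carrier]
      by (simp add: minus_one del: assoc_mult_mat)
    ultimately show ?thesis
      using out completed_imp_spanning[OF total] hconcat_unitary[OF total]
        blocks_of_size_congruence[OF H_carrier total assms(1)] blocks_of_size_congruence[OF K_carrier total assms(1)]
      by blast
  qed
qed

end
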